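(* Let $N=(\mathbb Z_2^n,+,\cdot)$ be a planar or Malone trivial nearring, let $M$ be its unique maximal ideal, where the proper ideals of $N$ are exactly the $\mathbb Z_2$-subspaces of $M$, and let $m=\dim_{\mathbb Z_2}M$. Suppose $m$ is even and $m\ge 4$. Put $a_0=1$ and $a_k=\prod_{i=1}^k(2^i-1)$ for $k\ge1$. Then the ideals contained in $M$ of dimension less than $\frac m2$, together with $N$ and a suitable set of $\frac{a_{m-1}}{a_{m/2}\,a_{m/2-1}}$ ideals of dimension $\frac m2$ contained in $M$, form a maximum clique in $\operatorname{CIG}(N)$; and the number of maximum cliques of $\operatorname{CIG}(N)$ is $2^{m+1}-2$.
   Context: Nearrings are right nearrings: $(N,+)$ is a group, $(N,\cdot)$ is a semigroup, $(a+b)c=ac+bc$. An ideal is a normal subgroup $I$ of $(N,+)$ with $IN\subseteq I$ and $n(n'+i)-nn'\in I$ for $n,n'\in N$, $i\in I$. A Malone trivial nearring on a non-trivial group $G$ is given by a subset $S\subseteq G\setminus\{0\}$ and the multiplication $ab=a$ if $b\in S$, $ab=0$ if $b\notin S$. A (right) nearring $N$ is planar if, writing $a\equiv b$ when $xa=xb$ for all $x\in N$, there are at least three $\equiv$-classes and for all $a\not\equiv b$ and all $c\in N$ the equation $xa=xb+c$ has a unique solution $x\in N$. The group $\mathbb Z_2^n$ is regarded as an $n$-dimensional vector space over $\mathbb Z_2$; the dimension of an ideal is its dimension as a subspace. An ideal $I$ is a complement of an ideal $K$ if it is maximal (among ideals) with respect to $K\cap I=\{0\}$; a complement ideal is a complement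 of some ideal. The complement ideal graph $\operatorname{CIG}(N)$ is the simple graph whose vertices are all ideals of $N$, distinct $I,J$ being adjacent iff $I+J$ is a complement ideal. A clique is a maximal complete subgraph; a maximum clique is a clique of largest order. *)

theory Defs
  imports "HOL-Analysis.Analysis" "HOL-Library.Z2" "HOL-Library.Ramsey" "HOL-Library.Set_Algebras"
begin

text \<open>A nearring has the addition of its type (a possibly non-commutative group) and an explicit
  multiplication, so that different nearrings can live on the same additive group.\<close>

locale right_nearring =
  fixes mul :: "'a::group_add \<Rightarrow> 'a \<Rightarrow> 'a"
  assumes mul_assoc: "mul (mul a b) c = mul a (mul b c)"
    and mul_add_distrib: "mul (a + b) c = mul a c + mul b c"

definition nr_ideal :: "('a::group_add \<Rightarrow> 'a \<Rightarrow> 'a) \<Rightarrow> 'a set \<Rightarrow> bool" where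
  "nr_ideal mul I \<longleftrightarrow>
     0 \<in> I \<and> (\<forall>i\<in>I. \<forall>j\<in>I. i + j \<in> I) \<and> (\<forall>i\<in>I. - i \<in> I) \<and> (\<forall>g. \<forall>i\<in>I. g + i - g \<in> I) \<and>
     (\<forall>i\<in>I. \<forall>n. mul i n \<in> I) \<and>
     (\<forall>n n'. \<forall>i\<in>I. mul n (n' + i) - mul n n' \<in> I)"

definition maximal_nr_ideal :: "('a::group_add \<Rightarrow> 'a \<Rightarrow> 'a) \<Rightarrow> 'a set \<Rightarrow> bool" where
  "maximal_nr_ideal mul I \<longleftrightarrow>
     nr_ideal mul I \<and> I \<noteq> UNIV \<and> (\<forall>J. nr_ideal mul J \<and> J \<noteq> UNIV \<and> I \<subseteq> J \<longrightarrow> J = I)"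

locale malone_trivial_nearring = right_nearring mul
  for mul :: "'a::group_add \<Rightarrow> 'a \<Rightarrow> 'a" +
  assumes nontrivial: "\<exists>x::'a. x \<noteq> 0"
    and malone: "\<exists>S. 0 \<notin> S \<and> (\<forall>a b. mul a b = (if b \<in> S then a else 0))"

definition mul_equiv :: "('a \<Rightarrow> 'a \<Rightarrow> 'b) \<Rightarrow> 'a \<Rightarrow> 'a \<Rightarrow> bool" where
  "mul_equiv mul a b \<longleftrightarrow> (\<forall>x. mul x a = mul x b)"

locale planar_nearring = right_nearring mul
  for mul :: "'a::group_add \<Rightarrow> 'a \<Rightarrow> 'a" +
  assumes three_classes:
      "\<exists>a b c. \<not> mul_equiv mul a b \<and> \<not> mul_equiv mul b c \<and> \<not> mul_equiv mul a c"
    and planar: "\<not> mul_equiv mul a b \<Longrightarrow> \<exists>!x. mul x a = mul x b + c"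

definition complement_of :: "('a::group_add \<Rightarrow> 'a \<Rightarrow> 'a) \<Rightarrow> 'a set \<Rightarrow> 'a set \<Rightarrow> bool" where
  "complement_of mul K I \<longleftrightarrow>
     nr_ideal mul I \<and> K \<inter> I = {0} \<and> (\<forall>J. nr_ideal mul J \<and> K \<inter> J = {0} \<and> I \<subseteq> J \<longrightarrow> J = I)"

definition complement_ideal :: "('a::group_add \<Rightarrow> 'a \<Rightarrow> 'a) \<Rightarrow> 'a set \<Rightarrow> bool" where
  "complement_ideal mul I \<longleftrightarrow> (\<exists>K. nr_ideal mul K \<and> complement_of mul K I)"

text \<open>A simple graph is given by its vertex set \<open>V\<close> and its set \<open>E\<close> of two-element edges.
  The sum of two ideals is the elementwise sum of sets.\<close>

definition CIG_verts :: "('a::group_add \<Rightarrow> 'a \<Rightarrow> 'a) \<Rightarrow> 'a set set" where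
  "CIG_verts mul = {I. nr_ideal mul I}"

definition CIG_edges :: "('a::group_add \<Rightarrow> 'a \<Rightarrow> 'a) \<Rightarrow> 'a set set set" where
  "CIG_edges mul =
     {{I, J} | I J. nr_ideal mul I \<and> nr_ideal mul J \<and> I \<noteq> J \<and> complement_ideal mul (I + J)}"

text \<open>The library constant \<open>clique\<close> expresses that all distinct vertices in a set are adjacent,
  i.e. that the set spans a complete subgraph; maximality is added here. Subgraphs are identified
  with their vertex sets. The second definition compares cardinalities with \<open>card\<close> and is
  meant for finite graphs.\<close>

definition maximal_clique :: "'v set \<Rightarrow> 'v set set \<Rightarrow> 'v set \<Rightarrow> bool" where
  "maximal_clique V E C \<longleftrightarrow>
     C \<subseteq> V \<and> clique C E \<and> (\<forall>D. D \<subseteq> V \<and> clique D E \<and> C \<subseteq> D \<longrightarrow> D = C)"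

definition maximum_clique :: "'v set \<Rightarrow> 'v set set \<Rightarrow> 'v set \<Rightarrow> bool" where
  "maximum_clique V E C \<longleftrightarrow>
     maximal_clique V E C \<and> (\<forall>D. maximal_clique V E D \<longrightarrow> card D \<le> card C)"

definition a_seq :: "nat \<Rightarrow> real" where
  "a_seq k = (\<Prod>i=1..k. 2 ^ i - 1)"

end

theory Submission
  imports "HOL-Algebra.Algebraic_Closure_Type" Defs
begin

text \<open>
  The ideals other than \<open>N\<close> are the subspaces of \<open>M\<close>, and every ideal except \<open>M\<close> is a complement
  ideal, so \<open>I\<close> and \<open>J\<close> are adjacent iff \<open>I + J \<noteq> M\<close>. Put \<open>m = 2 k\<close>. For \<open>i < k\<close> the relation
  ``being complementary in \<open>M\<close>'' is a regular bipartite graph between dimensions \<open>i\<close> and \<open>m - i\<close>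
  in which a clique induces an independent set; as any two subspaces of equal dimension have a common
  complement, a maximum clique takes all of dimension \<open>i\<close> and nothing of dimension \<open>m - i\<close>.

  In dimension \<open>k\<close> one needs the Erdos--Ko--Rado theorem for the intersecting families \<open>F\<close> of
  \<open>k\<close>-subspaces, including the equality case. A spread (\<open>2\<^sup>k + 1\<close> pairwise complementary
  \<open>k\<close>-subspaces) contains at most one member of \<open>F\<close>; averaging over its images under \<open>GL(M)\<close> gives
  the bound. In the case of equality every image contains exactly one member, and averaging only over
  the maps with \<open>g ` L = W\<close>, for suitable subspaces \<open>L\<close>, determines the number of members of \<open>F\<close> that
  meet \<open>W\<close> in dimension \<open>j\<close> from whether \<open>W \<in> F\<close>. Consequently the number \<open>deg p\<close> of members
  through \<open>p\<close> has the same sum over every \<open>W \<notin> F\<close>, which makes \<open>deg\<close> invariant under translation by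
  \<open>U \<in> F\<close> outside \<open>U\<close>. If the members of \<open>F\<close> had no common point and spanned \<open>M\<close>, then \<open>deg\<close> would
  be constant, contradicting that every two members intersect.
\<close>

section \<open>Finite fields of characteristic two and additive polynomials\<close>

text \<open>Over two scalars each further basis vector \<open>b\<close> doubles the span: it becomes
  the old span together with its coset by \<open>b\<close>. An arbitrary space is allowed because
  the count is applied both to \<open>bit ^ 'n\<close> and to pairs over the algebraic
  closure.\<close>

lemma card_span_bit:
  fixes scale :: "bit \<Rightarrow> 'b::ab_group_add \<Rightarrow> 'b"
  assumes "vector_space scale" "finite B" "\<not> module.dependent scale B"
  shows "card (module.span scale B) = 2 ^ card B"
proof -
  interpret vector_space scale by fact
  show ?thesis
    using assms(2,3)
  proof (induction B)
    case empty
    then show ?case by simp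
  next
    case (insert b B)
    have ind: "independent B" and nin: "b \<notin> span B"
      using insert.prems insert.hyps independent_insert by auto
    have split: "span (insert b B) = span B \<union> (+) b ` span B"
    proof (intro Set.set_eqI iffI)
      fix x assume "x \<in> span (insert b B)"
      then obtain c where c: "x - scale c b \<in> span B"
        by (auto simp: span_insert)
      show "x \<in> span B \<union> (+) b ` span B"
      proof (cases "c = 0")
        case True
        then show ?thesis using c by simp
      next
        case False
        then have "c = 1" by simp
        then have "x = b + (x - b)" "x - b \<in> span B" using c by auto
        then show ?thesis by blast
      qed
    next
      fix x assume "x \<in> span B \<union> (+) b ` span B"
      then show "x \<in> span (insert b B)"
        by (auto intro: span_add span_base span_mono[THEN subsetD, of B])
    qed
    have disj: "span B \<inter> (+) b ` span B = {}"
      using nin by (auto dest: span_diff)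
    have fin: "finite (span B)"
    proof (rule ccontr)
      assume "infinite (span B)"
      then show False using insert.IH[OF ind] by simp
    qed
    have "card (span (insert b B)) = card (span B) + card ((+) b ` span B)"
      unfolding split by (rule card_Un_disjoint) (use fin disj in auto)
    also have "card ((+) b ` span B) = card (span B)"
      by (rule card_image) (auto intro: injI)
    finally show ?case using insert.IH[OF ind] insert.hyps by simp
  qed
qed

lemma CHAR_bit: "CHAR(bit) = 2"
proof -
  have "of_nat n = (of_bool (odd n) :: bit)" for n
    by (induction n) auto
  then show ?thesis
    by (intro CHAR_eqI) auto
qed

lemma prime_CHAR_bit_alg_closure: "Factorial_Ring.prime CHAR(bit alg_closure)" "CHAR(bit alg_closure) = 2"
  by (simp_all add: CHAR_bit)

lemma ac_add_self [simp]: "x + x = (0 :: bit alg_closure)"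
proof -
  have "of_nat 2 = (0 :: bit alg_closure)"
    using prime_CHAR_bit_alg_closure(2) of_nat_CHAR by metis
  then have "2 * x = 0" by simp
  then show ?thesis by (simp only: mult_2)
qed

lemma ac_two [simp]: "2 = (0 :: bit alg_closure)"
  by (metis ac_add_self one_add_one)

lemma ac_uminus [simp]: "- x = (x :: bit alg_closure)"
  by (metis ac_add_self minus_unique)

lemma ac_diff [simp]: "x - y = x + (y :: bit alg_closure)"
  using ac_uminus[of y] by (metis diff_conv_add_uminus)

text \<open>These are the fixed points of the \<open>k\<close>-th power of the Frobenius map in an
  algebraic closure of the two-element field: for \<open>k > 0\<close> the field with
  \<open>2 ^ k\<close> elements, for \<open>k = 0\<close> the whole closure.\<close>

definition GF :: "nat \<Rightarrow> bit alg_closure set" where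
  "GF k = {x. x ^ (2 ^ k) = x}"

lemma GF_closed: "0 \<in> GF k" "x \<in> GF k \<Longrightarrow> y \<in> GF k \<Longrightarrow> x + y \<in> GF k"
  "x \<in> GF k \<Longrightarrow> y \<in> GF k \<Longrightarrow> x * y \<in> GF k"
proof -
  show "0 \<in> GF k" by (simp add: GF_def)
  show "x + y \<in> GF k" if "x \<in> GF k" "y \<in> GF k"
    using that freshmans_dream'[OF prime_CHAR_bit_alg_closure(1), of "2 ^ k" k x y]
    by (simp add: GF_def CHAR_bit)
  show "x * y \<in> GF k" if "x \<in> GF k" "y \<in> GF k"
    using that by (simp add: GF_def power_mult_distrib)
qed

text \<open>The elements are the zeros of X^(2^k) + X, which splits over the closure. Its derivative
  is 1, so no zero is multiple and their number is the degree.\<close>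

lemma card_GF:
  assumes "k > 0"
  shows "card (GF k) = 2 ^ k"
proof -
  define p :: "bit alg_closure poly" where "p = Polynomial.monom 1 (2 ^ k) + Polynomial.monom 1 1"
  have "poly p x = 0 \<longleftrightarrow> x \<in> GF k" for x
    by (auto simp: p_def GF_def poly_monom) (metis ac_add_self add_right_cancel)
  then have roots: "GF k = {x. poly p x = 0}" by auto
  have big: "(2::nat) ^ k > 1" using assms by (intro one_less_power) auto
  have deg: "degree p = 2 ^ k"
    unfolding p_def by (subst degree_add_eq_left) (use big in \<open>auto simp: degree_monom_eq\<close>)
  have pd: "pderiv p = 1"
    using assms by (simp add: p_def pderiv_add pderiv_monom monom_0 power_0_left one_pCons)
  have p0: "p \<noteq> 0" using deg by (metis degree_0 power_not_zero zero_neq_numeral)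
  obtain A where A: "size A = degree p" "p = Polynomial.smult (Polynomial.lead_coeff p) (\<Prod>x\<in>#A. [:-x, 1:])"
    using alg_closed_imp_factorization[OF p0] by blast
  have "proots (\<Prod>x\<in>#A. [:-x, 1:]) = A"
  proof (induction A)
    case (add x A)
    have nz: "(\<Prod>x\<in>#A. [:-x, 1:]) \<noteq> 0" by (force simp: prod_mset_zero_iff)
    have "proots ([:-x, 1:] * (\<Prod>x\<in>#A. [:-x, 1:])) = proots [:-x, 1:] + proots (\<Prod>x\<in>#A. [:-x, 1:])"
      by (rule proots_mult) (use nz in auto)
    then show ?case
      unfolding add.IH proots_linear_factor minus_minus image_mset_add_mset prod_mset.add_mset by simp
  qed auto
  then have prA: "proots p = A"
    using A(2) p0 by (metis proots_smult leading_coeff_0_iff)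
  have "order x p \<le> 1" for x
  proof (rule ccontr)
    assume "\<not> order x p \<le> 1"
    then have "[:-x, 1:] ^ 2 dvd p"
      using order_1[of x p] by (metis dvd_trans le_imp_power_dvd not_less_eq_eq numeral_2_eq_2 One_nat_def)
    then obtain q where "p = [:-x, 1:] ^ 2 * q" by (rule dvdE)
    then have q: "p = [:-x, 1:] * ([:-x, 1:] * q)"
      by (simp only: power2_eq_square mult.assoc)
    have "poly (pderiv p) x = 0"
      unfolding q by (simp only: pderiv_mult poly_add poly_mult) (simp add: algebra_simps)
    then show False using pd by simp
  qed
  then have "count A x \<le> 1" for x
    using p0 by (metis prA count_proots)
  then have "count A x = count (mset_set (set_mset A)) x" for x
    using count_greater_zero_iff[of A x] by (cases "x \<in># A") (auto simp: not_in_iff intro!: le_antisym)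
  then have "A = mset_set (set_mset A)" by (rule multiset_eqI)
  then have "card (set_mset A) = size A" by (metis size_mset_set)
  then have "card {x. poly p x = 0} = degree p"
    using prA p0 A(1) by (metis set_count_proots)
  then show ?thesis using roots deg by simp
qed


text \<open>All zeros that the degree admits lie in \<open>GF k\<close>. In
  \<open>spread_exists\<close> the degree bounds an intersection by dimension \<open>j\<close>, and
  the exact count attains this bound.\<close>

lemma additive_polynomial_exists:
  assumes "j \<le> k" "k > 0"
  shows "\<exists>p :: bit alg_closure poly. Polynomial.degree p = 2 ^ j \<and>
    (\<forall>x y. poly p (x + y) = poly p x + poly p y) \<and> (\<forall>x\<in>GF k. poly p x \<in> GF k) \<and>
    card {x \<in> GF k. poly p x = 0} = 2 ^ j"
  using assms(1)
proof (induction j)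
  case 0
  have "{x \<in> GF k. poly [:0, 1:] x = 0} = {0}" using GF_closed(1) by auto
  then show ?case by (intro exI[of _ "[:0, 1:]"]) auto
next
  case (Suc j)
  then obtain p :: "bit alg_closure poly" where p: "Polynomial.degree p = 2 ^ j"
    "\<And>x y. poly p (x + y) = poly p x + poly p y" "\<And>x. x \<in> GF k \<Longrightarrow> poly p x \<in> GF k"
    "card {x \<in> GF k. poly p x = 0} = 2 ^ j"
    by auto
  define Z where "Z = {x \<in> GF k. poly p x = 0}"
  have fK: "finite (GF k)" using card_GF[OF assms(2)] by (metis card.infinite power_not_zero zero_neq_numeral)
  have "card Z < card (GF k)"
    using Suc.prems p(4) card_GF[OF assms(2)] by (simp add: Z_def)
  \<comment> \<open>\<open>Z\<close> has \<open>2 ^ j < 2 ^ k\<close> elements, so some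
    \<open>w\<close> has a nonzero value \<open>c\<close>; translating \<open>Z\<close> by
    \<open>w\<close> gives the second half of the new kernel.\<close>
  then obtain w where w: "w \<in> GF k" "w \<notin> Z"
    by (metis (no_types, lifting) Z_def less_irrefl mem_Collect_eq subsetI subset_antisym)
  define c where "c = poly p w"
  have c: "c \<noteq> 0" "c \<in> GF k" using w p(3) by (auto simp: Z_def c_def)
  txt \<open>In characteristic two this \<open>q\<close> is additive and \<open>q x = p x * p (x + w)\<close>, so its kernel is twice
    as large as that of \<open>p\<close>.\<close>
  define q where "q = p * p + Polynomial.smult c p"
  have p0: "p \<noteq> 0" using p(1) by auto
  have "Polynomial.degree (p * p) = 2 ^ Suc j" using p(1) p0 by (simp add: degree_mult_eq)
  moreover have "Polynomial.degree (Polynomial.smult c p) < 2 ^ Suc j" using p(1) c by simp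
  ultimately have deg: "Polynomial.degree q = 2 ^ Suc j"
    unfolding q_def by (metis degree_add_eq_left)
  have add: "poly q (x + y) = poly q x + poly q y" for x y
  proof -
    have "poly q (x + y) = poly q x + poly q y + (poly p x * poly p y + poly p x * poly p y)"
      by (simp only: q_def p(2) poly_add poly_mult poly_smult) (simp add: algebra_simps)
    then show ?thesis by simp
  qed
  have cl: "\<forall>x\<in>GF k. poly q x \<in> GF k"
    using p(3) c GF_closed by (simp add: q_def)
  have zero: "poly q x = 0 \<longleftrightarrow> poly p x = 0 \<or> poly p (x + w) = 0" for x
  proof -
    have "poly q x = poly p x * (poly p (x + w))"
      by (simp add: q_def p(2) c_def algebra_simps)
    then show ?thesis by simp
  qed
  have ww: "w + (w + x) = x" for x :: "bit alg_closure"
    by (simp flip: add.assoc)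
  have "{x \<in> GF k. poly q x = 0} = Z \<union> (+) w ` Z"
    using w GF_closed(2)[of _ k w] ww
    by (auto simp: zero Z_def image_iff add.commute) (metis add.commute ww)
  moreover have "Z \<inter> (+) w ` Z = {}"
    using w by (auto simp: Z_def p(2))
  moreover have "card ((+) w ` Z) = card Z" by (rule card_image) (auto intro: injI)
  moreover have "finite Z" using fK by (simp add: Z_def)
  ultimately have "card {x \<in> GF k. poly q x = 0} = 2 ^ Suc j"
    using p(4) by (simp add: card_Un_disjoint flip: Z_def)
  then show ?case using deg add cl by blast
qed

section \<open>Subspaces over the two-element field\<close>

lemma card_subspace_bit:
  fixes U :: "(bit ^ 'n) set"
  assumes "vec.subspace U"
  shows "card U = 2 ^ vec.dim U"
proof -
  obtain B where B: "B \<subseteq> U" "vec.independent B" "U \<subseteq> vec.span B" "card B = vec.dim U"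
    by (rule vec.basis_exists)
  have "card (vec.span B) = 2 ^ card B"
    by (rule card_span_bit) (use B in \<open>auto intro: vec.finiteI_independent simp: vec.vector_space_axioms\<close>)
  then show ?thesis
    using B assms by (metis vec.span_minimal subset_antisym)
qed

lemma card_nonzero_subspace:
  fixes U :: "(bit ^ 'n) set"
  assumes "vec.subspace U"
  shows "card (U - {0}) = 2 ^ vec.dim U - 1"
  using card_subspace_bit[OF assms] vec.subspace_0[OF assms] by (simp add: card_Diff_singleton)

lemma vec_dim_eq_iff:
  fixes U :: "(bit ^ 'n) set"
  assumes "vec.subspace U"
  shows "vec.dim U = d \<longleftrightarrow> card U = 2 ^ d"
  using card_subspace_bit[OF assms] by simp

definition Gr :: "(bit ^ 'n) set \<Rightarrow> nat \<Rightarrow> (bit ^ 'n) set set" where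
  "Gr M d = {U. vec.subspace U \<and> U \<subseteq> M \<and> vec.dim U = d}"

text \<open>The plane over the closure is viewed as a space over \<open>bit\<close> only, so that a
  linear map can carry a finite part of it onto a subspace of \<open>bit ^ 'n\<close>.\<close>

definition pscale :: "bit \<Rightarrow> bit alg_closure \<times> bit alg_closure \<Rightarrow> bit alg_closure \<times> bit alg_closure" where
  "pscale c z = (to_ac c * fst z, to_ac c * snd z)"

interpretation pair: vector_space pscale
  by unfold_locales (auto simp: pscale_def algebra_simps)

interpretation pair_vec: vector_space_pair pscale "(*s) :: bit \<Rightarrow> bit ^ 'n \<Rightarrow> bit ^ 'n" ..

text \<open>The only scalars are 0 and 1, so closure under addition suffices; the same holds for
  \<open>subspace_bitI\<close>.\<close>

lemma pair_subspaceI: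
  assumes "0 \<in> Q" "\<And>x y. x \<in> Q \<Longrightarrow> y \<in> Q \<Longrightarrow> x + y \<in> Q"
  shows "pair.subspace Q"
proof -
  have "pscale c x \<in> Q" if "x \<in> Q" for c x
    using that assms(1) by (cases "c = 0") (auto simp: pscale_def zero_prod_def)
  then show ?thesis using assms by (auto simp: pair.subspace_def)
qed

section \<open>Spreads\<close>

definition spread :: "(bit ^ 'n) set \<Rightarrow> nat \<Rightarrow> (bit ^ 'n) set set \<Rightarrow> bool" where
  "spread M k S \<longleftrightarrow> S \<subseteq> Gr M k \<and> card S = 2 ^ k + 1 \<and> (\<forall>A\<in>S. \<forall>B\<in>S. A \<noteq> B \<longrightarrow> A \<inter> B = {0})"

text \<open>The spread consists of the lines through the origin in the plane over \<open>GF(2\<^sup>k)\<close>. The subspace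
  \<open>L\<close> for \<open>j\<close> is the graph of an additive polynomial \<open>p\<close> of degree \<open>2\<^sup>j\<close>: it meets the line of slope
  \<open>a\<close> in the roots of \<open>p x - a x\<close>, at most \<open>2\<^sup>j\<close> many, with equality for \<open>a = 0\<close>.\<close>
lemma spread_exists:
  fixes M :: "(bit ^ 'n) set"
  assumes M: "vec.subspace M" "vec.dim M = 2 * k" and k: "k > 0"
  obtains S where "spread M k S"
    "\<forall>j\<in>{1..k}. \<exists>L\<in>Gr M k. (\<forall>A\<in>S. vec.dim (L \<inter> A) \<le> j) \<and> (\<exists>A\<in>S. vec.dim (L \<inter> A) = j)"
proof -
  define K where "K = GF k"
  define P where "P = K \<times> K"
  have cK: "card K = 2 ^ k" using card_GF[OF k] by (simp add: K_def)
  have fK: "finite K" using cK by (metis card.infinite power_not_zero zero_neq_numeral)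
  have K: "0 \<in> K" "\<And>x y. x \<in> K \<Longrightarrow> y \<in> K \<Longrightarrow> x + y \<in> K" "\<And>x y. x \<in> K \<Longrightarrow> y \<in> K \<Longrightarrow> x * y \<in> K"
    using GF_closed by (auto simp: K_def)
  have fP: "finite P" using fK by (simp add: P_def)
  have sP: "pair.subspace P"
    by (rule pair_subspaceI) (use K in \<open>auto simp: P_def zero_prod_def\<close>)
  obtain B where B: "B \<subseteq> P" "pair.independent B" "P \<subseteq> pair.span B" "card B = pair.dim P"
    by (rule pair.basis_exists)
  have fB: "finite B" using B fP finite_subset by auto
  have "pair.span B = P" using B sP by (metis pair.span_minimal subset_antisym)
  then have "card P = 2 ^ pair.dim P"
    using card_span_bit[OF pair.vector_space_axioms fB] B by simp
  moreover have "card P = 2 ^ (2 * k)" by (simp add: P_def card_cartesian_product cK mult_2 power_add)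
  \<comment> \<open>Finite spaces over \<open>bit\<close> of equal size have equal dimension, so a
    linear \<open>f\<close> carries the plane \<open>P\<close> over \<open>K\<close> onto
    \<open>M\<close>.\<close>
  ultimately have dP: "pair.dim P = vec.dim M" by (simp add: M)
  obtain C where C: "C \<subseteq> M" "vec.independent C" "M \<subseteq> vec.span C" "card C = vec.dim M"
    by (rule vec.basis_exists)
  obtain f where f: "Vector_Spaces.linear pscale (*s) f" "f ` P = M" "inj_on f P"
    using pair_vec.finite_basis_to_basis_subspace_isomorphism[OF sP M(1) dP fB B vec.finiteI_independent[OF C(2)] C]
    by blast
  have sub: "vec.subspace (f ` Q)" if "0 \<in> Q" "\<And>x y. x \<in> Q \<Longrightarrow> y \<in> Q \<Longrightarrow> x + y \<in> Q" for Q
    by (rule pair_vec.linear_subspace_image[OF f(1)]) (rule pair_subspaceI[OF that])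
  \<comment> \<open>\<open>g h\<close> is the graph of \<open>h\<close>. The lines of finite slope
    and the subspaces \<open>L\<close> are both images of such graphs, with \<open>h\<close>
    additive on the closure and preserving \<open>K\<close>.\<close>
  define g where "g h = (\<lambda>x. (x, h x)) ` K" for h :: "bit alg_closure \<Rightarrow> bit alg_closure"
  have g: "f ` g h \<in> Gr M k" "g h \<subseteq> P" if "\<And>x y. h (x + y) = h x + h y" "\<And>x. x \<in> K \<Longrightarrow> h x \<in> K" for h
  proof -
    have h0: "h 0 = 0" using that(1)[of 0 0] by simp
    show gP: "g h \<subseteq> P" using that by (auto simp: g_def P_def)
    have s: "vec.subspace (f ` g h)"
    proof (rule sub)
      show "0 \<in> g h" using K h0 by (auto simp: g_def zero_prod_def image_iff intro!: bexI[of _ 0])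
      show "x + y \<in> g h" if "x \<in> g h" "y \<in> g h" for x y
        using that K \<open>\<And>x y. h (x + y) = h x + h y\<close> by (auto simp: g_def image_iff)
    qed
    have "card (f ` g h) = card (g h)"
      by (rule card_image) (use f(3) gP inj_on_subset in blast)
    also have "\<dots> = 2 ^ k" unfolding g_def using cK by (subst card_image) (auto intro: inj_onI)
    finally show "f ` g h \<in> Gr M k"
      using s gP f(2) vec_dim_eq_iff[OF s] by (auto simp: Gr_def)
  qed
  \<comment> \<open>The vertical line is the only line that is not a graph; with the
    \<open>2 ^ k\<close> slopes it makes \<open>2 ^ k + 1\<close> lines.\<close>
  define N where "N = {0 :: bit alg_closure} \<times> K"
  have NP: "N \<subseteq> P" using K by (auto simp: N_def P_def)
  have N: "f ` N \<in> Gr M k"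
  proof -
    have s: "vec.subspace (f ` N)"
      by (rule sub) (use K in \<open>auto simp: N_def zero_prod_def\<close>)
    have "card (f ` N) = card N"
      by (rule card_image) (use f(3) NP inj_on_subset in blast)
    also have "\<dots> = 2 ^ k" by (simp add: N_def card_cartesian_product cK)
    finally show ?thesis using s NP f(2) vec_dim_eq_iff[OF s] by (auto simp: Gr_def)
  qed
  define l where "l a = g ((*) a)" for a
  have l: "f ` l a \<in> Gr M k" "l a \<subseteq> P" if "a \<in> K" for a
    unfolding l_def by (rule g; use that K in \<open>auto simp: algebra_simps\<close>)+
  have f0: "f 0 = 0" using f(1) by (rule pair_vec.linear_0)
  have Int: "f ` R \<inter> f ` Y = f ` (R \<inter> Y)" if "R \<subseteq> P" "Y \<subseteq> P" for R Y
    by (rule inj_on_image_Int[OF f(3) that, symmetric])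
  define S where "S = insert (f ` N) ((\<lambda>a. f ` l a) ` K)"
  have ll: "l a \<inter> l b = {0}" if "a \<noteq> b" for a b
    using that K by (auto simp: l_def g_def zero_prod_def image_iff)
  have lN: "l a \<inter> N = {0}" for a
    using K by (auto simp: l_def g_def zero_prod_def image_iff N_def)
  have inter: "A \<inter> B = {0}" if "A \<in> S" "B \<in> S" "A \<noteq> B" for A B
  proof -
    have lil: "f ` l a \<inter> f ` l b = {0}" if "a \<in> K" "b \<in> K" "a \<noteq> b" for a b
      using that l ll[OF that(3)] Int f0 by simp
    have lin: "f ` l a \<inter> f ` N = {0}" if "a \<in> K" for a
      using that l lN NP Int f0 by simp
    have "(A = f ` N \<or> (\<exists>a\<in>K. A = f ` l a)) \<and> (B = f ` N \<or> (\<exists>a\<in>K. B = f ` l a))"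
      using that(1,2) by (auto simp: S_def)
    then consider "A = f ` N" "B = f ` N" | b where "b \<in> K" "A = f ` N" "B = f ` l b"
      | a where "a \<in> K" "A = f ` l a" "B = f ` N" | a b where "a \<in> K" "A = f ` l a" "b \<in> K" "B = f ` l b"
      by blast
    then show ?thesis
    proof cases
      case 1
      then show ?thesis using that(3) by simp
    next
      case (2 b)
      then show ?thesis using lin[of b] by (simp add: Int_commute)
    next
      case (3 a)
      then show ?thesis by (simp only: lin)
    next
      case (4 a b)
      then have "a \<noteq> b" using that(3) by blast
      then show ?thesis using 4 lil by (simp only:)
    qed
  qed
  have nontriv: "A \<noteq> {0}" if "A \<in> Gr M k" for A
    using that k by (auto simp: Gr_def)
  have SG: "S \<subseteq> Gr M k" using N l by (auto simp: S_def)
  have inj: "inj_on (\<lambda>a. f ` l a) K"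
  proof (rule inj_onI, rule ccontr)
    fix a b assume ab: "a \<in> K" "b \<in> K" "f ` l a = f ` l b" "a \<noteq> b"
    then have "f ` l a = {0}" using l ll[OF ab(4)] Int[of "l a" "l b"] f0 by simp
    then show False using nontriv l ab by blast
  qed
  have notin: "f ` N \<notin> (\<lambda>a. f ` l a) ` K"
  proof
    assume "f ` N \<in> (\<lambda>a. f ` l a) ` K"
    then obtain a where a: "a \<in> K" "f ` N = f ` l a" by auto
    then have "f ` l a = {0}" using l lN Int[of "l a" N] NP f0 by simp
    then show False using nontriv l a by blast
  qed
  have cS: "card S = 2 ^ k + 1"
    unfolding S_def using notin fK card_image[OF inj] cK by simp
  have "\<exists>R. R \<in> Gr M k \<and> (\<forall>A\<in>S. vec.dim (R \<inter> A) \<le> j) \<and> (\<exists>A\<in>S. vec.dim (R \<inter> A) = j)"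
    if j: "1 \<le> j" "j \<le> k" for j
  proof -
    obtain p :: "bit alg_closure poly" where p: "Polynomial.degree p = 2 ^ j"
      "\<And>x y. poly p (x + y) = poly p x + poly p y" "\<And>x. x \<in> K \<Longrightarrow> poly p x \<in> K"
      "card {x \<in> K. poly p x = 0} = 2 ^ j"
      using additive_polynomial_exists[OF j(2) k] by (auto simp: K_def)
    define R where "R = g (poly p)"
    have R: "f ` R \<in> Gr M k" "R \<subseteq> P" unfolding R_def by (rule g; use p in auto)+
    have p0: "poly p 0 = 0" using p(2)[of 0 0] by simp
    have si: "vec.subspace (A \<inter> B)" if "A \<in> Gr M k" "B \<in> Gr M k" for A B
      using that by (auto simp: Gr_def intro: vec.subspace_inter)
    have "f ` R \<inter> f ` N = {0}"
      using Int[OF R(2) NP] p0 K f0 by (auto simp: R_def g_def N_def zero_prod_def image_iff)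
    then have dN: "vec.dim (f ` R \<inter> f ` N) \<le> j" by simp
    have cl: "card (f ` R \<inter> f ` l a) = card {x \<in> K. poly p x = a * x}" if "a \<in> K" for a
    proof -
      have "R \<inter> l a = (\<lambda>x. (x, a * x)) ` {x \<in> K. poly p x = a * x}"
        by (auto simp: R_def l_def g_def image_iff)
      then have "card (R \<inter> l a) = card {x \<in> K. poly p x = a * x}"
        by (simp add: card_image inj_on_def)
      moreover have "card (f ` (R \<inter> l a)) = card (R \<inter> l a)"
        by (rule card_image, rule inj_on_subset[OF f(3)]) (use R(2) in auto)
      ultimately show ?thesis unfolding Int[OF R(2) l(2)[OF that]] by metis
    qed
    have dl: "vec.dim (f ` R \<inter> f ` l a) \<le> j" if a: "a \<in> K" for a
    proof -
      \<comment> \<open>In characteristic two this is \<open>p x - a x\<close>. As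
        \<open>j \<ge> 1\<close>, the degree \<open>2 ^ j\<close> exceeds 1, so the linear term does
        not change it.\<close>
      define q where "q = p + [:0, a:]"
      have "(1::nat) < 2 ^ j" using j by (intro one_less_power) auto
      moreover have "Polynomial.degree [:0, a:] \<le> 1" by simp
      ultimately have dq: "Polynomial.degree q = 2 ^ j"
        unfolding q_def using p(1) by (subst degree_add_eq_left) linarith+
      then have q0: "q \<noteq> 0" using \<open>1 < 2 ^ j\<close> by auto
      have "{x \<in> K. poly p x = a * x} \<subseteq> {x. poly q x = 0}"
        by (auto simp: q_def mult.commute)
      then have "card {x \<in> K. poly p x = a * x} \<le> card {x. poly q x = 0}"
        using poly_roots_finite[OF q0] by (rule card_mono[rotated])
      also have "\<dots> \<le> 2 ^ j" using card_poly_roots_bound[OF q0] dq by simp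
      finally have "2 ^ vec.dim (f ` R \<inter> f ` l a) \<le> (2::nat) ^ j"
        using cl[OF a] card_subspace_bit[OF si[OF R(1) l(1)[OF a]]] by simp
      then show ?thesis by simp
    qed
    have "vec.dim (f ` R \<inter> f ` l 0) = j"
      using cl[OF K(1)] p(4) vec_dim_eq_iff[OF si[OF R(1) l(1)[OF K(1)]]] by simp
    moreover have "f ` l 0 \<in> S" using K by (auto simp: S_def)
    ultimately show ?thesis using R dN dl by (intro exI[of _ "f ` R"]) (auto simp: S_def)
  qed
  moreover have "spread M k S" using SG cS inter by (simp add: spread_def)
  ultimately show ?thesis by (intro that[of S]) (auto simp: Bex_def)
qed

section \<open>Vectors in characteristic two and bases adapted to two subspaces\<close>

instance bit :: finite
proof
  have "(UNIV :: bit set) = {0, 1}" by auto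
  then show "finite (UNIV :: bit set)" by (metis finite.emptyI finite.insertI)
qed

lemma vec_bit_add_self [simp]: "x + x = (0 :: bit ^ 'n)"
  by (simp add: vec_eq_iff)

lemma vec_bit_add_cancel [simp]: "x + (x + y) = (y :: bit ^ 'n)"
  by (simp flip: add.assoc)

lemma vec_bit_diff [simp]: "x - y = (x + y :: bit ^ 'n)"
  by (simp add: vec_eq_iff)

lemma subspace_bitI:
  fixes U :: "(bit ^ 'n) set"
  assumes "0 \<in> U" "\<And>x y. x \<in> U \<Longrightarrow> y \<in> U \<Longrightarrow> x + y \<in> U"
  shows "vec.subspace U"
proof -
  have "c *s x \<in> U" if "x \<in> U" for c x
    using that assms(1) by (cases "c = 0") auto
  then show ?thesis using assms by (auto simp: vec.subspace_def)
qed

lemma subspace_bit_add_iff: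
  fixes U :: "(bit ^ 'n) set"
  assumes "vec.subspace U" "u \<in> U"
  shows "u + v \<in> U \<longleftrightarrow> v \<in> U" "v + u \<in> U \<longleftrightarrow> v \<in> U"
  using assms vec.subspace_add[of U u] vec_bit_add_cancel[of u v] by (metis add.commute)+

text \<open>This is the span of \<open>U\<close> and \<open>v\<close> when \<open>U\<close> is a
  subspace: with two scalars a single coset suffices, which makes membership and size easy to
  handle.\<close>

definition adjoin :: "bit ^ 'n \<Rightarrow> (bit ^ 'n) set \<Rightarrow> (bit ^ 'n) set" where
  "adjoin v U = U \<union> (+) v ` U"

lemma adjoin:
  assumes "vec.subspace U"
  shows "vec.subspace (adjoin v U)" "U \<subseteq> adjoin v U" "v \<in> adjoin v U"
    "v \<notin> U \<Longrightarrow> vec.dim (adjoin v U) = vec.dim U + 1"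
proof -
  have U: "0 \<in> U" "\<And>x y. x \<in> U \<Longrightarrow> y \<in> U \<Longrightarrow> x + y \<in> U"
    using assms by (auto intro: vec.subspace_0 vec.subspace_add)
  show sub: "vec.subspace (adjoin v U)"
  proof (rule subspace_bitI)
    fix x y assume "x \<in> adjoin v U" "y \<in> adjoin v U"
    then consider "x \<in> U" "y \<in> U" | u where "u \<in> U" "x = v + u" "y \<in> U"
      | u where "u \<in> U" "y = v + u" "x \<in> U" | u w where "u \<in> U" "x = v + u" "w \<in> U" "y = v + w"
      by (auto simp: adjoin_def)
    then show "x + y \<in> adjoin v U"
    proof cases
      case (2 u)
      then have "x + y = v + (u + y)" by (simp add: algebra_simps)
      then show ?thesis using 2 U(2) by (auto simp: adjoin_def)
    next
      case (3 u)
      then have "x + y = v + (x + u)" by (simp add: algebra_simps)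
      then show ?thesis using 3 U(2) by (auto simp: adjoin_def)
    next
      case (4 u w)
      then have "x + y = (v + v) + (u + w)" by (simp only: ac_simps)
      then show ?thesis using 4 U(2) by (auto simp: adjoin_def)
    qed (use U in \<open>auto simp: adjoin_def\<close>)
  qed (use U in \<open>auto simp: adjoin_def\<close>)
  show "U \<subseteq> adjoin v U" by (auto simp: adjoin_def)
  show "v \<in> adjoin v U" using U(1) by (auto simp: adjoin_def image_iff intro!: bexI[of _ 0])
  show "vec.dim (adjoin v U) = vec.dim U + 1" if v: "v \<notin> U"
  proof -
    have "U \<inter> (+) v ` U = {}"
      using v assms by (auto simp: subspace_bit_add_iff)
    moreover have "card ((+) v ` U) = card U" by (rule card_image) (auto intro: injI)
    ultimately have "card (adjoin v U) = 2 * card U"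
      by (simp add: adjoin_def card_Un_disjoint)
    then show ?thesis using card_subspace_bit[OF assms] vec_dim_eq_iff[OF sub] by simp
  qed
qed

lemma adjoin_subset: "vec.subspace M \<Longrightarrow> U \<subseteq> M \<Longrightarrow> v \<in> M \<Longrightarrow> adjoin v U \<subseteq> M"
  by (auto simp: adjoin_def subset_iff intro: vec.subspace_add)

lemma dim_add_Int:
  fixes U W :: "(bit ^ 'n) set"
  assumes "vec.subspace U" "vec.subspace W"
  shows "vec.dim (U + W) + vec.dim (U \<inter> W) = vec.dim U + vec.dim W"
proof -
  have "U + W = {x + y |x y. x \<in> U \<and> y \<in> W}" by (auto simp: set_plus_def)
  then show ?thesis using vec.dim_sums_Int[OF assms] by simp
qed

lemma subspace_add_set:
  fixes U W :: "(bit ^ 'n) set"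
  assumes "vec.subspace U" "vec.subspace W"
  shows "vec.subspace (U + W)" "U \<subseteq> U + W" "W \<subseteq> U + W"
proof -
  have "U + W = {x + y |x y. x \<in> U \<and> y \<in> W}" by (auto simp: set_plus_def)
  then show "vec.subspace (U + W)" using vec.subspace_sums[OF assms] by simp
  show "U \<subseteq> U + W" "W \<subseteq> U + W"
    using assms[THEN vec.subspace_0] by (auto simp: set_plus_def) (metis add.right_neutral, metis add.left_neutral)
qed

lemma add_set_subset: "vec.subspace M \<Longrightarrow> U \<subseteq> M \<Longrightarrow> W \<subseteq> M \<Longrightarrow> U + W \<subseteq> M"
  by (auto simp: set_plus_def subset_iff intro: vec.subspace_add)

text \<open>A basis \<open>D\<close> of the intersection is extended to bases \<open>A\<close> and
  \<open>B\<close>. Their union spans \<open>W + Z\<close> and has at most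
  \<open>vec.dim (W + Z)\<close> elements, so it is independent, and then \<open>A\<close> and
  \<open>B\<close> share no more than \<open>D\<close>.\<close>

lemma basis_pair_exists:
  fixes W Z :: "(bit ^ 'n) set"
  assumes "vec.subspace W" "vec.subspace Z"
  obtains A B where "vec.independent (A \<union> B)" "vec.span A = W" "vec.span B = Z"
    "card A = vec.dim W" "card B = vec.dim Z" "card (A \<inter> B) = vec.dim (W \<inter> Z)"
proof -
  obtain D where D: "D \<subseteq> W \<inter> Z" "vec.independent D" "W \<inter> Z \<subseteq> vec.span D" "card D = vec.dim (W \<inter> Z)"
    by (rule vec.basis_exists)
  obtain A where A: "D \<subseteq> A" "A \<subseteq> W" "vec.independent A" "W \<subseteq> vec.span A"
    using vec.maximal_independent_subset_extend[of D W] D by auto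
  obtain B where B: "D \<subseteq> B" "B \<subseteq> Z" "vec.independent B" "Z \<subseteq> vec.span B"
    using vec.maximal_independent_subset_extend[of D Z] D by auto
  have sA: "vec.span A = W" and sB: "vec.span B = Z"
    using A B assms by (metis vec.span_minimal subset_antisym)+
  have cA: "card A = vec.dim W" and cB: "card B = vec.dim Z"
    using A B by (auto intro: vec.basis_card_eq_dim)
  have AB: "card (A \<union> B) + card (A \<inter> B) = card A + card B"
    using card_Un_Int[of A B] by simp
  have DAB: "card D \<le> card (A \<inter> B)"
    using A B by (intro card_mono) auto
  have "W \<subseteq> vec.span (A \<union> B)" "Z \<subseteq> vec.span (A \<union> B)"
    using vec.span_mono[of A "A \<union> B"] vec.span_mono[of B "A \<union> B"] sA sB by auto
  then have sp: "W + Z \<subseteq> vec.span (A \<union> B)" by (rule add_set_subset[OF vec.subspace_span])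
  have le: "card (A \<union> B) \<le> vec.dim (W + Z)"
    using AB DAB cA cB D(4) dim_add_Int[OF assms] by linarith
  have sub: "A \<union> B \<subseteq> W + Z" using A B subspace_add_set[OF assms] by blast
  have ind: "vec.independent (A \<union> B)"
    using vec.card_le_dim_spanning[OF sub sp _ le] by simp
  have "card (A \<union> B) = vec.dim (W + Z)"
    using ind sub sp by (auto intro: vec.basis_card_eq_dim)
  then have "card (A \<inter> B) = vec.dim (W \<inter> Z)"
    using AB cA cB dim_add_Int[OF assms] by linarith
  then show ?thesis using that[OF ind sA sB cA cB] by simp
qed

section \<open>The general linear group of a subspace\<close>

text \<open>Automorphisms of the ambient space that preserve \<open>M\<close> are used instead of
  automorphisms of \<open>M\<close>, so that composition and images involve total maps. Different
  elements may agree on \<open>M\<close>; the averages below are not affected.\<close>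

definition GL :: "(bit ^ 'n) set \<Rightarrow> (bit ^ 'n \<Rightarrow> bit ^ 'n) set" where
  "GL M = {g. Vector_Spaces.linear (*s) (*s) g \<and> bij g \<and> g ` M = M}"

text \<open>Both independent sets are completed to bases of \<open>M\<close> and the added vectors
  are matched arbitrarily. The bijection of bases extends to an injective linear map of the ambient
  space, bijective by finiteness.\<close>

lemma GL_extend:
  fixes M :: "(bit ^ 'n) set"
  assumes M: "vec.subspace M"
    and B: "B \<subseteq> M" "vec.independent B"
    and f: "inj_on f B" "f ` B \<subseteq> M" "vec.independent (f ` B)"
  obtains g where "g \<in> GL M" "\<And>b. b \<in> B \<Longrightarrow> g b = f b"
proof -
  obtain B1 where B1: "B \<subseteq> B1" "B1 \<subseteq> M" "vec.independent B1" "M \<subseteq> vec.span B1"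
    using vec.maximal_independent_subset_extend[OF B] by auto
  obtain C1 where C1: "f ` B \<subseteq> C1" "C1 \<subseteq> M" "vec.independent C1" "M \<subseteq> vec.span C1"
    using vec.maximal_independent_subset_extend[OF f(2,3)] by auto
  have "card B1 = card C1" using B1 C1 by (metis vec.basis_card_eq_dim)
  then have "card (B1 - B) = card (C1 - f ` B)"
    using B1 C1 card_image[OF f(1)] by (simp add: card_Diff_subset)
  then obtain h where h: "bij_betw h (B1 - B) (C1 - f ` B)"
    by (metis bij_betw_iff_card finite)
  define k where "k x = (if x \<in> B then f x else h x)" for x
  have "bij_betw k (B \<union> (B1 - B)) (f ` B \<union> (C1 - f ` B))"
  proof (rule bij_betw_combine)
    show "bij_betw k B (f ` B)"
      using f(1) by (auto simp: bij_betw_def k_def inj_on_def)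
    show "bij_betw k (B1 - B) (C1 - f ` B)"
      using h by (subst bij_betw_cong[of _ _ h]) (auto simp: k_def)
  qed auto
  moreover have "B \<union> (B1 - B) = B1" "f ` B \<union> (C1 - f ` B) = C1" using B1 C1 by auto
  ultimately have k: "bij_betw k B1 C1" by simp
  then have kk: "inj_on k B1" "k ` B1 = C1" by (auto simp: bij_betw_def)
  obtain g where g: "Vector_Spaces.linear (*s) (*s) g" "inj g" "\<And>x. x \<in> B1 \<Longrightarrow> g x = k x"
    using vec.linear_independent_extend_inj[of B1 k] kk B1 C1 by auto
  have "surj g" using g(2) by (simp add: finite_UNIV_inj_surj)
  have sp: "vec.span B1 = M" "vec.span C1 = M" using B1 C1 M by (metis vec.span_minimal subset_antisym)+
  have "g ` B1 = C1" using g(3) kk(2) by (metis image_cong)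
  then have "g ` M = M" using vec.linear_span_image[OF g(1), of B1] sp by simp
  then have "g \<in> GL M" using g \<open>surj g\<close> by (auto simp: GL_def bij_def)
  moreover have "g b = f b" if "b \<in> B" for b using that g(3)[of b] B1 by (auto simp: k_def)
  ultimately show ?thesis using that by blast
qed

text \<open>Pairs of subspaces are classified under \<open>GL M\<close> by three dimensions. Adapted
  bases are matched separately on \<open>A \<inter> B\<close>, \<open>A - B\<close> and
  \<open>B - A\<close>.\<close>

lemma GL_pair:
  fixes M :: "(bit ^ 'n) set"
  assumes M: "vec.subspace M"
    and W: "vec.subspace W" "W \<subseteq> M" "vec.subspace Z" "Z \<subseteq> M"
    and W': "vec.subspace W'" "W' \<subseteq> M" "vec.subspace Z'" "Z' \<subseteq> M"
    and dims: "vec.dim W = vec.dim W'" "vec.dim Z = vec.dim Z'" "vec.dim (W \<inter> Z) = vec.dim (W' \<inter> Z')"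
  obtains g where "g \<in> GL M" "g ` W = W'" "g ` Z = Z'"
proof -
  obtain A B where AB: "vec.independent (A \<union> B)" "vec.span A = W" "vec.span B = Z"
    "card A = vec.dim W" "card B = vec.dim Z" "card (A \<inter> B) = vec.dim (W \<inter> Z)"
    using basis_pair_exists[OF W(1,3)] .
  obtain A' B' where AB': "vec.independent (A' \<union> B')" "vec.span A' = W'" "vec.span B' = Z'"
    "card A' = vec.dim W'" "card B' = vec.dim Z'" "card (A' \<inter> B') = vec.dim (W' \<inter> Z')"
    using basis_pair_exists[OF W'(1,3)] .
  have "card (A \<inter> B) = card (A' \<inter> B')" "card (A - B) = card (A' - B')" "card (B - A) = card (B' - A')"
    using AB AB' dims by (auto simp: card_Diff_subset_Int Int_commute)
  then obtain f1 f2 f3 where f: "bij_betw f1 (A \<inter> B) (A' \<inter> B')" "bij_betw f2 (A - B) (A' - B')"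
      "bij_betw f3 (B - A) (B' - A')"
    by (metis bij_betw_iff_card finite)
  define f where "f x = (if x \<in> A \<inter> B then f1 x else if x \<in> A then f2 x else f3 x)" for x
  have f': "bij_betw f (A \<inter> B) (A' \<inter> B')" "bij_betw f (A - B) (A' - B')" "bij_betw f (B - A) (B' - A')"
    using f by (subst bij_betw_cong[of _ _ f1] bij_betw_cong[of _ _ f2] bij_betw_cong[of _ _ f3]; auto simp: f_def)+
  have eqs: "A \<inter> B \<union> (A - B) = A" "A' \<inter> B' \<union> (A' - B') = A'" "A \<inter> B \<union> (B - A) = B" "A' \<inter> B' \<union> (B' - A') = B'"
    "A \<union> (B - A) = A \<union> B" "A' \<union> (B' - A') = A' \<union> B'"
    by auto
  have fA: "bij_betw f A A'"
    using bij_betw_combine[OF f'(1,2)] eqs by auto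
  have fB: "bij_betw f B B'"
    using bij_betw_combine[OF f'(1,3)] eqs by auto
  have fAB: "bij_betw f (A \<union> B) (A' \<union> B')"
    using bij_betw_combine[OF fA f'(3)] eqs by auto
  have "A \<union> B \<subseteq> M" "A' \<union> B' \<subseteq> M"
    using AB AB' W W' vec.span_superset by blast+
  then obtain g where g: "g \<in> GL M" "\<And>b. b \<in> A \<union> B \<Longrightarrow> g b = f b"
    using GL_extend[OF M, of "A \<union> B" f] AB(1) AB'(1) fAB by (metis bij_betw_def)
  have lin: "Vector_Spaces.linear (*s) (*s) g" using g by (simp add: GL_def)
  have "g ` A = A'" "g ` B = B'"
    using g(2) fA fB by (auto simp: bij_betw_def image_def)
  then have "g ` W = W'" "g ` Z = Z'"
    using vec.linear_span_image[OF lin] AB AB' by metis+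
  then show ?thesis using that g by blast
qed

lemma GL_compose: "g \<in> GL M \<Longrightarrow> h \<in> GL M \<Longrightarrow> g \<circ> h \<in> GL M"
proof -
  assume "g \<in> GL M" "h \<in> GL M"
  moreover from this have "(g \<circ> h) ` M = M" unfolding image_comp[symmetric] by (simp add: GL_def)
  ultimately show ?thesis by (auto simp: GL_def bij_comp intro: Vector_Spaces.linear_compose)
qed

lemma id_GL: "id \<in> GL M"
  by (auto simp: GL_def vec.linear_id)

lemma GL_add: "g \<in> GL M \<Longrightarrow> g (x + y) = g x + g y"
  by (auto simp: GL_def vec.linear_add)

lemma GL_0: "g \<in> GL M \<Longrightarrow> g 0 = 0"
  by (auto simp: GL_def vec.linear_0)

lemma GL_inj: "g \<in> GL M \<Longrightarrow> inj g"
  by (auto simp: GL_def bij_def)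

lemma GL_Gr:
  assumes "g \<in> GL M" "U \<in> Gr M d"
  shows "g ` U \<in> Gr M d"
proof -
  have s: "vec.subspace U" "U \<subseteq> M" "vec.dim U = d" using assms by (auto simp: Gr_def)
  have "vec.subspace (g ` U)" using assms s by (auto simp: GL_def intro: vec.linear_subspace_image)
  moreover have "card (g ` U) = card U" using GL_inj[OF assms(1)] by (simp add: card_image inj_on_subset)
  moreover have "g ` U \<subseteq> M" using assms s by (auto simp: GL_def)
  ultimately show ?thesis using vec_dim_eq_iff card_subspace_bit[OF s(1)] s(3) by (auto simp: Gr_def)
qed

lemma GL_transitive:
  assumes "vec.subspace M" "W \<in> Gr M d" "W' \<in> Gr M d"
  obtains g where "g \<in> GL M" "g ` W = W'"
  using GL_pair[OF assms(1), of W W W' W'] assms(2,3) by (auto simp: Gr_def)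

lemma GL_transitive_pair:
  assumes "vec.subspace M" "W \<in> Gr M d" "W' \<in> Gr M d" "Z \<in> Gr M e" "Z' \<in> Gr M e"
    "vec.dim (W \<inter> Z) = vec.dim (W' \<inter> Z')"
  obtains g where "g \<in> GL M" "g ` W = W'" "g ` Z = Z'"
  using GL_pair[OF assms(1), of W Z W' Z'] assms(2-) by (auto simp: Gr_def)

section \<open>Counting subspaces\<close>

lemma a_seq_pos: "a_seq d > 0"
proof -
  have "(2::real) ^ i - 1 > 0" if "i \<in> {1..d}" for i
    using that one_less_power[of "2::real" i] by simp
  then show ?thesis unfolding a_seq_def by (rule prod_pos)
qed

lemma a_seq_0: "a_seq 0 = 1"
  by (simp add: a_seq_def)

lemma a_seq_Suc: "a_seq (Suc d) = a_seq d * (2 ^ Suc d - 1)"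
  by (simp add: a_seq_def)

definition indep_lists :: "(bit ^ 'n) set \<Rightarrow> nat \<Rightarrow> (bit ^ 'n) list set" where
  "indep_lists M d = {xs. length xs = d \<and> distinct xs \<and> vec.independent (set xs) \<and> set xs \<subseteq> M}"

lemma finite_indep_lists: "finite (indep_lists (M :: (bit ^ 'n) set) d)"
  by (rule finite_subset[OF _ finite_lists_length_eq[of M d]]) (auto simp: indep_lists_def)

lemma card_span_indep_list:
  assumes "xs \<in> indep_lists M d"
  shows "card (vec.span (set xs)) = 2 ^ d" "vec.dim (vec.span (set xs)) = d"
proof -
  have "vec.dim (vec.span (set xs)) = card (set xs)"
    using assms by (intro vec.dim_span_eq_card_independent) (simp add: indep_lists_def)
  also have "\<dots> = d" using assms by (auto simp: indep_lists_def distinct_card)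
  finally show "vec.dim (vec.span (set xs)) = d" .
  then show "card (vec.span (set xs)) = 2 ^ d" using card_subspace_bit[OF vec.subspace_span] by metis
qed

text \<open>A list is prolonged by any vector of \<open>M\<close> outside the span of the earlier
  ones, and that span has \<open>2 ^ d\<close> elements. Ordering the vectors makes the numbers of
  choices multiply.\<close>

lemma card_indep_lists:
  fixes M :: "(bit ^ 'n) set"
  assumes M: "vec.subspace M" and "d \<le> vec.dim M"
  shows "real (card (indep_lists M d)) = (\<Prod>i<d. 2 ^ vec.dim M - 2 ^ i)"
  using assms(2)
proof (induction d)
  case 0
  have "indep_lists M 0 = {[]}" by (auto simp: indep_lists_def vec.independent_empty)
  then show ?case by simp
next
  case (Suc d)
  let ?S = "SIGMA xs:indep_lists M d. M - vec.span (set xs)"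
  have "bij_betw (\<lambda>(xs, x). x # xs) ?S (indep_lists M (Suc d))"
    unfolding bij_betw_def
  proof
    show "inj_on (\<lambda>(xs, x). x # xs) ?S" by (auto simp: inj_on_def)
    show "(\<lambda>(xs, x). x # xs) ` ?S = indep_lists M (Suc d)"
    proof (intro Set.set_eqI iffI)
      fix ys assume "ys \<in> (\<lambda>(xs, x). x # xs) ` ?S"
      then obtain x xs where x: "ys = x # xs" "x \<in> M" "x \<notin> vec.span (set xs)" "xs \<in> indep_lists M d"
        by auto
      then have "vec.independent (insert x (set xs))"
        by (intro vec.independent_insertI) (auto simp: indep_lists_def)
      then show "ys \<in> indep_lists M (Suc d)"
        using x vec.span_base[of x "set xs"] by (auto simp: indep_lists_def)
    next
      fix ys assume ys: "ys \<in> indep_lists M (Suc d)"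
      then obtain x xs where x: "ys = x # xs" by (auto simp: indep_lists_def length_Suc_conv)
      then have "(xs, x) \<in> ?S" using ys by (auto simp: indep_lists_def vec.independent_insert)
      then show "ys \<in> (\<lambda>(xs, x). x # xs) ` ?S" using x by force
    qed
  qed
  then have "card (indep_lists M (Suc d)) = card ?S" by (simp add: bij_betw_same_card)
  also have "\<dots> = (\<Sum>xs\<in>indep_lists M d. card (M - vec.span (set xs)))"
    by (simp add: finite_indep_lists)
  also have "\<dots> = (\<Sum>xs\<in>indep_lists M d. 2 ^ vec.dim M - 2 ^ d)"
  proof (rule sum.cong[OF refl])
    fix xs assume xs: "xs \<in> indep_lists M d"
    then have "vec.span (set xs) \<subseteq> M" using M by (auto simp: indep_lists_def intro: vec.span_minimal[THEN subsetD])
    then show "card (M - vec.span (set xs)) = 2 ^ vec.dim M - 2 ^ d"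
      using card_span_indep_list[OF xs] card_subspace_bit[OF M] by (simp add: card_Diff_subset)
  qed
  finally have "card (indep_lists M (Suc d)) = card (indep_lists M d) * (2 ^ vec.dim M - 2 ^ d)" by simp
  moreover have "(2::nat) ^ d \<le> 2 ^ vec.dim M" using Suc.prems by (intro power_increasing) auto
  ultimately show ?case using Suc by (simp add: of_nat_diff)
qed

text \<open>Each factor is \<open>2 ^ i * (2 ^ (m - i) - 1)\<close>, and the second parts are
  exactly the factors of \<open>a_seq m\<close> that \<open>a_seq (m - d)\<close> lacks.\<close>

lemma prod_pow_diff_eq:
  assumes "d \<le> m"
  shows "(\<Prod>i<d. (2::real) ^ m - 2 ^ i) * a_seq (m - d) = (\<Prod>i<d. 2 ^ i) * a_seq m"
  using assms
proof (induction d)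
  case (Suc d)
  have "m - d = Suc (m - Suc d)" using Suc.prems by simp
  then have "a_seq (m - d) = a_seq (m - Suc d) * (2 ^ (m - d) - 1)" using a_seq_Suc by metis
  moreover have "(2::real) ^ m - 2 ^ d = 2 ^ d * (2 ^ (m - d) - 1)"
    using Suc.prems by (simp add: algebra_simps flip: power_add)
  ultimately have "(\<Prod>i<Suc d. (2::real) ^ m - 2 ^ i) * a_seq (m - Suc d) = (\<Prod>i<d. (2::real) ^ m - 2 ^ i) * a_seq (m - d) * 2 ^ d"
    by simp
  then show ?case using Suc by simp
qed simp

text \<open>The Gaussian binomial coefficient for two elements: independent lists of length
  \<open>d\<close> are sorted by their span, and every \<open>d\<close>-dimensional subspace carries
  the same number of them.\<close>

lemma card_Gr:
  fixes M :: "(bit ^ 'n) set"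
  assumes M: "vec.subspace M" and d: "d \<le> vec.dim M"
  shows "real (card (Gr M d)) = a_seq (vec.dim M) / (a_seq d * a_seq (vec.dim M - d))"
proof -
  let ?p = "\<Prod>i<d. (2::real) ^ d - 2 ^ i"
  have eq: "indep_lists M d = (\<Union>U\<in>Gr M d. indep_lists U d)"
  proof (intro Set.set_eqI iffI)
    fix xs assume xs: "xs \<in> indep_lists M d"
    then have "vec.span (set xs) \<in> Gr M d" "xs \<in> indep_lists (vec.span (set xs)) d"
      using M card_span_indep_list[OF xs]
      by (auto simp: Gr_def indep_lists_def intro: vec.span_base vec.span_minimal[THEN subsetD])
    then show "xs \<in> (\<Union>U\<in>Gr M d. indep_lists U d)" by blast
  qed (auto simp: Gr_def indep_lists_def)
  have span: "vec.span (set xs) = U" if "xs \<in> indep_lists U d" "U \<in> Gr M d" for xs U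
    using that card_span_indep_list[OF that(1)]
    by (intro vec.subspace_dim_equal) (auto simp: Gr_def indep_lists_def intro: vec.span_minimal[THEN subsetD])
  have "card (indep_lists M d) = (\<Sum>U\<in>Gr M d. card (indep_lists U d))"
    unfolding eq
  proof (rule card_UN_disjoint)
    show "\<forall>U\<in>Gr M d. \<forall>W\<in>Gr M d. U \<noteq> W \<longrightarrow> indep_lists U d \<inter> indep_lists W d = {}"
      using span by blast
  qed (auto simp: finite_indep_lists)
  then have "real (card (indep_lists M d)) = (\<Sum>U\<in>Gr M d. real (card (indep_lists U d)))" by simp
  also have "\<dots> = (\<Sum>U\<in>Gr M d. ?p)"
    by (rule sum.cong) (auto simp: Gr_def card_indep_lists)
  finally have "(\<Prod>i<d. 2 ^ vec.dim M - 2 ^ i) = real (card (Gr M d)) * ?p"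
    using card_indep_lists[OF M d] by simp
  then have "(\<Prod>i<d. 2 ^ i) * a_seq (vec.dim M) = real (card (Gr M d)) * a_seq (vec.dim M - d) * ((\<Prod>i<d. 2 ^ i) * a_seq d)"
    using prod_pow_diff_eq[OF d] prod_pow_diff_eq[of d d] by (simp add: a_seq_0 mult_ac)
  moreover have "(\<Prod>i<d. (2::real) ^ i) > 0" by (rule prod_pos) simp
  ultimately have "a_seq (vec.dim M) = real (card (Gr M d)) * (a_seq d * a_seq (vec.dim M - d))"
    by (simp add: algebra_simps)
  then show ?thesis using a_seq_pos[of d] a_seq_pos[of "vec.dim M - d"] by (simp add: field_simps)
qed

lemma card_Gr_sym:
  fixes M :: "(bit ^ 'n) set"
  assumes "vec.subspace M" "d \<le> vec.dim M"
  shows "card (Gr M d) = card (Gr M (vec.dim M - d))"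
proof -
  have "real (card (Gr M d)) = real (card (Gr M (vec.dim M - d)))"
    using assms by (simp add: card_Gr mult.commute)
  then show ?thesis by simp
qed

section \<open>Complements\<close>

text \<open>The sum of the two spans contains \<open>C\<close>, so its dimension is at least
  \<open>card C\<close>; the dimension formula then leaves 0 for the intersection.\<close>

lemma independent_split:
  fixes C :: "(bit ^ 'n) set"
  assumes "vec.independent C" "A \<subseteq> C"
  shows "vec.span A \<inter> vec.span (C - A) = {0}" "vec.dim (vec.span (C - A)) = card C - card A"
proof -
  have ind: "vec.independent A" "vec.independent (C - A)"
    using assms vec.independent_mono by blast+
  have d: "vec.dim (vec.span A) = card A" "vec.dim (vec.span (C - A)) = card (C - A)"
    using ind by (auto intro!: vec.dim_span_eq_card_independent simp del: vec.dim_span)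
  have "card A \<le> card C" using assms by (intro card_mono) auto
  have cd: "card (C - A) = card C - card A" using assms by (intro card_Diff_subset) auto
  then show "vec.dim (vec.span (C - A)) = card C - card A" using d by simp
  have "C \<subseteq> vec.span A + vec.span (C - A)"
  proof
    fix x assume "x \<in> C"
    then have "x \<in> vec.span A \<or> x \<in> vec.span (C - A)" by (auto intro: vec.span_base)
    then show "x \<in> vec.span A + vec.span (C - A)"
      using subspace_add_set(2,3)[OF vec.subspace_span vec.subspace_span] by blast
  qed
  then have "card C \<le> vec.dim (vec.span A + vec.span (C - A))"
    using assms(1) by (intro vec.independent_card_le_dim)
  then have "vec.dim (vec.span A \<inter> vec.span (C - A)) = 0"
    using dim_add_Int[OF vec.subspace_span vec.subspace_span, of A "C - A"] d cd \<open>card A \<le> card C\<close> by linarith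
  then show "vec.span A \<inter> vec.span (C - A) = {0}"
    using vec.span_zero[of A] vec.span_zero[of "C - A"] by auto
qed

text \<open>Bases of \<open>A\<close> and \<open>R\<close> are disjoint and jointly independent;
  complete them to a basis of \<open>M\<close> and drop the part in \<open>A\<close>. The prescribed
  \<open>R\<close> lets \<open>deg_shift\<close> and \<open>card_extremal_sets\<close> choose
  complements through a given vector.\<close>

lemma complement_exists:
  fixes M :: "(bit ^ 'n) set"
  assumes M: "vec.subspace M" and A: "A \<in> Gr M i" and R: "vec.subspace R" "R \<subseteq> M" "A \<inter> R = {0}"
  obtains B where "B \<in> Gr M (vec.dim M - i)" "R \<subseteq> B" "A \<inter> B = {0}"
proof -
  have A': "vec.subspace A" "A \<subseteq> M" "vec.dim A = i" using A by (auto simp: Gr_def)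
  obtain a r where ar: "vec.independent (a \<union> r)" "vec.span a = A" "vec.span r = R"
    "card a = vec.dim A" "card (a \<inter> r) = vec.dim (A \<inter> R)"
    using basis_pair_exists[OF A'(1) R(1)] .
  have disj: "a \<inter> r = {}" using ar(5) R(3) by simp
  have "a \<union> r \<subseteq> M" using ar A' R vec.span_superset by blast
  then obtain C where C: "a \<union> r \<subseteq> C" "C \<subseteq> M" "vec.independent C" "M \<subseteq> vec.span C"
    using vec.maximal_independent_subset_extend[OF _ ar(1)] by blast
  have cC: "card C = vec.dim M" using C by (auto intro: vec.basis_card_eq_dim)
  let ?B = "vec.span (C - a)"
  have "A \<inter> ?B = {0}" "vec.dim ?B = vec.dim M - i"
    using independent_split[of C a] C ar A' cC by auto
  moreover have "?B \<subseteq> M" using C M by (intro vec.span_minimal) auto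
  moreover have "r \<subseteq> C - a" using C disj by blast
  then have "R \<subseteq> ?B" using ar(3) vec.span_mono by metis
  ultimately show ?thesis using that[of ?B] by (auto simp: Gr_def)
qed

lemma Gr_between:
  fixes M :: "(bit ^ 'n) set"
  assumes M: "vec.subspace M" and R: "vec.subspace R" "R \<subseteq> M" "vec.dim R \<le> d" "d \<le> vec.dim M"
  obtains U where "U \<in> Gr M d" "R \<subseteq> U"
proof -
  have "\<exists>U. U \<in> Gr M (vec.dim R + e) \<and> R \<subseteq> U" if "vec.dim R + e \<le> vec.dim M" for e
    using that
  proof (induction e)
    case 0
    then show ?case using R by (auto simp: Gr_def)
  next
    case (Suc e)
    then obtain U where U: "U \<in> Gr M (vec.dim R + e)" "R \<subseteq> U" by auto
    then have U': "vec.subspace U" "U \<subseteq> M" "vec.dim U = vec.dim R + e" by (auto simp: Gr_def)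
    then have "U \<noteq> M" using Suc.prems by auto
    then obtain v where v: "v \<in> M" "v \<notin> U" using U' by auto
    have "adjoin v U \<in> Gr M (vec.dim R + Suc e)"
      using adjoin[OF U'(1), of v] adjoin_subset[OF M U'(2) v(1)] v U' by (auto simp: Gr_def)
    moreover have "R \<subseteq> adjoin v U" using U(2) adjoin(2)[OF U'(1)] by blast
    ultimately show ?case by blast
  qed
  from this[of "d - vec.dim R"] R that show ?thesis by auto
qed

text \<open>Induction on the codimension: pick \<open>v\<close> in \<open>M\<close> outside both
  subspaces, take a common complement of the two enlarged by \<open>v\<close>, and adjoin
  \<open>v\<close> to it.\<close>

lemma common_complement:
  fixes M :: "(bit ^ 'n) set"
  assumes M: "vec.subspace M" and "A \<in> Gr M i" "A' \<in> Gr M i"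
  shows "\<exists>B\<in>Gr M (vec.dim M - i). A \<inter> B = {0} \<and> A' \<inter> B = {0}"
  using assms(2,3)
proof (induction "vec.dim M - i" arbitrary: i A A')
  case 0
  have "{0} \<in> Gr M (vec.dim M - i)"
    unfolding 0(1)[symmetric] using M by (auto simp: Gr_def vec.subspace_0)
  moreover have "0 \<in> A" "0 \<in> A'" using 0 by (auto simp: Gr_def vec.subspace_0)
  ultimately show ?case by (intro bexI[of _ "{0}"]) auto
next
  case (Suc e)
  have A: "vec.subspace A" "A \<subseteq> M" "vec.dim A = i" and A': "vec.subspace A'" "A' \<subseteq> M" "vec.dim A' = i"
    using Suc.prems by (auto simp: Gr_def)
  \<comment> \<open>The inequality is strict because 0 is counted in both subspaces; so the two do
    not cover \<open>M\<close>.\<close>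
  have "card (A \<union> A') < card M"
  proof -
    have "0 \<in> A \<inter> A'" using A A' by (auto simp: vec.subspace_0)
    then have "card (A \<inter> A') > 0" by (auto simp: card_gt_0_iff)
    then have "card (A \<union> A') < 2 ^ i + 2 ^ i"
      using card_Un_Int[of A A'] card_subspace_bit[OF A(1)] card_subspace_bit[OF A'(1)] A A' by simp
    also have "\<dots> = 2 ^ Suc i" by simp
    also have "\<dots> \<le> 2 ^ vec.dim M" using Suc.hyps by (intro power_increasing) auto
    finally show ?thesis using card_subspace_bit[OF M] by simp
  qed
  then obtain v where v: "v \<in> M" "v \<notin> A" "v \<notin> A'"
    using A A' by (metis UnCI Un_least less_irrefl subsetI subset_antisym)
  have ad: "adjoin v A \<in> Gr M (Suc i)" "adjoin v A' \<in> Gr M (Suc i)"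
    using adjoin[OF A(1), of v] adjoin_subset[OF M A(2) v(1)] adjoin[OF A'(1), of v] adjoin_subset[OF M A'(2) v(1)] v A A'
    by (auto simp: Gr_def)
  have e: "e = vec.dim M - Suc i" using Suc.hyps(2) by linarith
  obtain B where B: "B \<in> Gr M (vec.dim M - Suc i)" "adjoin v A \<inter> B = {0}" "adjoin v A' \<inter> B = {0}"
    using Suc.hyps(1)[OF e ad] by (elim bexE conjE)
  then have B': "vec.subspace B" "B \<subseteq> M" "vec.dim B = vec.dim M - Suc i" by (auto simp: Gr_def)
  have "v \<noteq> 0" using v A by (auto simp: vec.subspace_0)
  then have "v \<notin> B" using B(2) adjoin(3)[OF A(1), of v] by blast
  then have AB: "adjoin v B \<in> Gr M (vec.dim M - i)"
    using adjoin[OF B'(1), of v] adjoin_subset[OF M B'(2) v(1)] B'(3) Suc.hyps(2) by (auto simp: Gr_def)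
  \<comment> \<open>If \<open>x = v + b\<close> lies in \<open>C\<close>, then \<open>b\<close> lies
    in both \<open>adjoin v C\<close> and \<open>B\<close>; hence \<open>b = 0\<close>, and
    \<open>v\<close> would be in \<open>C\<close>.\<close>
  have key: "C \<inter> adjoin v B = {0}" if C: "vec.subspace C" "v \<notin> C" "adjoin v C \<inter> B = {0}" for C
  proof -
    have "x = 0" if x: "x \<in> C" "x \<in> adjoin v B" for x
    proof (cases "x \<in> B")
      case True
      then show ?thesis using x C adjoin(2)[OF C(1), of v] by blast
    next
      case False
      then obtain b where b: "b \<in> B" "x = v + b" using x by (auto simp: adjoin_def)
      then have "b = v + x" by simp
      then have "b \<in> adjoin v C" using x by (auto simp: adjoin_def)
      then have "b = 0" using b C by blast
      then show ?thesis using b x C by simp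
    qed
    moreover have "0 \<in> C \<inter> adjoin v B"
      using C(1) B'(1) adjoin(1)[OF B'(1), of v] by (auto simp: vec.subspace_0)
    ultimately show ?thesis by blast
  qed
  show ?case using AB key[OF A(1) v(2) B(2)] key[OF A'(1) v(3) B(3)] by blast
qed

text \<open>\<open>GL M\<close> is transitive on \<open>Gr M i\<close> and preserves trivial
  intersection. This is the regularity of the complementarity graph.\<close>

lemma complement_degree:
  fixes M :: "(bit ^ 'n) set"
  assumes M: "vec.subspace M" and "U \<in> Gr M i" "U' \<in> Gr M i"
  shows "card {W \<in> Gr M j. U \<inter> W = {0}} = card {W \<in> Gr M j. U' \<inter> W = {0}}"
proof -
  have le: "card {W \<in> Gr M j. U \<inter> W = {0}} \<le> card {W \<in> Gr M j. U' \<inter> W = {0}}"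
    if UU: "U \<in> Gr M i" "U' \<in> Gr M i" for U U'
  proof -
    obtain g where g: "g \<in> GL M" "g ` U = U'" using GL_transitive[OF M UU] .
    have "inj_on ((`) g) {W \<in> Gr M j. U \<inter> W = {0}}"
      using GL_inj[OF g(1)] by (auto simp: inj_on_def inj_image_eq_iff)
    moreover have "(`) g ` {W \<in> Gr M j. U \<inter> W = {0}} \<subseteq> {W \<in> Gr M j. U' \<inter> W = {0}}"
    proof clarify
      fix W assume W: "W \<in> Gr M j" "U \<inter> W = {0}"
      have "U' \<inter> g ` W = g ` (U \<inter> W)" using g GL_inj[OF g(1)] by (metis image_Int)
      then show "g ` W \<in> Gr M j \<and> U' \<inter> g ` W = {0}" using W GL_Gr[OF g(1)] GL_0[OF g(1)] by simp
    qed
    ultimately show ?thesis by (rule card_inj_on_le) simp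
  qed
  show ?thesis using le assms by (intro le_antisym) auto
qed

section \<open>Intersecting families in the middle dimension\<close>

text \<open>Composition with a map taking \<open>(W, Z)\<close> to \<open>(W', Z')\<close> injects
  one set into the other. For fixed dimensions of the targets, the count thus depends only on how
  they meet.\<close>

lemma GL_count_pair:
  fixes M :: "(bit ^ 'n) set"
  assumes M: "vec.subspace M" and W: "W \<in> Gr M d" "W' \<in> Gr M d" "Z \<in> Gr M e" "Z' \<in> Gr M e"
    "vec.dim (W \<inter> Z) = vec.dim (W' \<inter> Z')"
  shows "card {g \<in> GL M. g ` L = W \<and> g ` S = Z} = card {g \<in> GL M. g ` L = W' \<and> g ` S = Z'}"
proof -
  have le: "card {g \<in> GL M. g ` L = W \<and> g ` S = Z} \<le> card {g \<in> GL M. g ` L = W' \<and> g ` S = Z'}"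
    if W: "W \<in> Gr M d" "W' \<in> Gr M d" "Z \<in> Gr M e" "Z' \<in> Gr M e" "vec.dim (W \<inter> Z) = vec.dim (W' \<inter> Z')"
    for W W' Z Z'
  proof -
    obtain h where h: "h \<in> GL M" "h ` W = W'" "h ` Z = Z'" using GL_transitive_pair[OF M W] .
    have "inj_on ((\<circ>) h) {g \<in> GL M. g ` L = W \<and> g ` S = Z}"
      using GL_inj[OF h(1)] by (auto simp: inj_on_def fun_eq_iff)
    moreover have "(\<circ>) h ` {g \<in> GL M. g ` L = W \<and> g ` S = Z} \<subseteq> {g \<in> GL M. g ` L = W' \<and> g ` S = Z'}"
      using h GL_compose[OF h(1)] by (auto simp flip: image_comp)
    ultimately show ?thesis by (rule card_inj_on_le) simp
  qed
  show ?thesis using le[OF W] le[OF W(2,1,4,3)] W(5) by simp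
qed

lemma GL_count:
  fixes M :: "(bit ^ 'n) set"
  assumes M: "vec.subspace M" and "W \<in> Gr M d" "W' \<in> Gr M d"
  shows "card {g \<in> GL M. g ` S = W} = card {g \<in> GL M. g ` S = W'}"
  using GL_count_pair[OF M assms(2,3,2,3), of S S] assms(2,3) by (simp add: Gr_def)

text \<open>The orbit-stabiliser equation: sort \<open>GL M\<close> by the image of
  \<open>A\<close>; all classes have equal size.\<close>

lemma card_Gr_times_stabilizer:
  fixes M :: "(bit ^ 'n) set"
  assumes M: "vec.subspace M" and A: "A \<in> Gr M d" and B: "B \<in> Gr M d"
  shows "card (Gr M d) * card {g \<in> GL M. g ` A = B} = card (GL M)"
proof -
  have "GL M = (\<Union>W\<in>Gr M d. {g \<in> GL M. g ` A = W})"
    using GL_Gr A by auto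
  then have "card (GL M) = card (\<Union>W\<in>Gr M d. {g \<in> GL M. g ` A = W})" by simp
  also have "\<dots> = (\<Sum>W\<in>Gr M d. card {g \<in> GL M. g ` A = W})"
    by (rule card_UN_disjoint) auto
  also have "\<dots> = (\<Sum>W\<in>Gr M d. card {g \<in> GL M. g ` A = B})"
    using GL_count[OF M _ B] by (intro sum.cong) auto
  finally show ?thesis by simp
qed

lemma card_filter_eq_sum: "finite A \<Longrightarrow> card {x \<in> A. P x} = (\<Sum>x\<in>A. if P x then 1 else 0)"
  by (simp add: sum.If_cases Int_def)

lemma card_double_count:
  assumes "finite A" "finite B"
  shows "(\<Sum>a\<in>A. card {b \<in> B. P a b}) = (\<Sum>b\<in>B. card {a \<in> A. P a b})"
  using assms by (simp add: card_filter_eq_sum) (rule sum.swap)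

section \<open>The bound for intersecting families, by averaging over spreads\<close>

locale intersecting_family =
  fixes M :: "(bit ^ 'n) set" and k :: nat and F :: "(bit ^ 'n) set set"
  assumes M: "vec.subspace M" "vec.dim M = 2 * k" and k: "k > 0"
    and F: "F \<subseteq> Gr M k" and meet: "\<And>A B. A \<in> F \<Longrightarrow> B \<in> F \<Longrightarrow> A \<inter> B \<noteq> {0}"
begin

lemma spread_translate:
  assumes "spread M k S" "g \<in> GL M"
  shows "card {A \<in> S. g ` A \<in> F} \<le> 1"
proof -
  have "A = B" if "A \<in> S" "g ` A \<in> F" "B \<in> S" "g ` B \<in> F" for A B
  proof (rule ccontr)
    assume "A \<noteq> B"
    then have "A \<inter> B = {0}" using assms that by (simp add: spread_def)
    then have "g ` A \<inter> g ` B = {0}"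
      using image_Int[OF GL_inj[OF assms(2)], of A B] GL_0[OF assms(2)] by simp
    then show False using meet that by blast
  qed
  then show ?thesis by (simp add: card_le_Suc0_iff_eq)
qed

text \<open>Triples of \<open>g\<close>, \<open>A\<close> in \<open>S\<close> and \<open>B\<close>
  in \<open>F\<close> with \<open>g\<close> mapping \<open>A\<close> to \<open>B\<close> are counted
  in two ways. The factor \<open>card (Gr M k)\<close> clears the denominator of the
  average.\<close>

lemma spread_average:
  assumes S: "S \<subseteq> Gr M k"
  shows "card (Gr M k) * (\<Sum>g\<in>GL M. card {A \<in> S. g ` A \<in> F}) = card S * card F * card (GL M)"
proof -
  have "(\<Sum>g\<in>GL M. card {A \<in> S. g ` A \<in> F}) = (\<Sum>A\<in>S. card {g \<in> GL M. g ` A \<in> F})"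
    by (rule card_double_count) auto
  also have "\<dots> = (\<Sum>A\<in>S. \<Sum>B\<in>F. card {g \<in> GL M. g ` A = B})"
  proof (rule sum.cong[OF refl])
    fix A assume "A \<in> S"
    have "{g \<in> GL M. g ` A \<in> F} = (\<Union>B\<in>F. {g \<in> GL M. g ` A = B})" by auto
    then show "card {g \<in> GL M. g ` A \<in> F} = (\<Sum>B\<in>F. card {g \<in> GL M. g ` A = B})"
      by (simp only:) (rule card_UN_disjoint, auto)
  qed
  finally have "card (Gr M k) * (\<Sum>g\<in>GL M. card {A \<in> S. g ` A \<in> F}) =
    (\<Sum>A\<in>S. \<Sum>B\<in>F. card (Gr M k) * card {g \<in> GL M. g ` A = B})"
    by (simp add: sum_distrib_left)
  also have "\<dots> = (\<Sum>A\<in>S. \<Sum>B\<in>F. card (GL M))"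
    by (intro sum.cong refl card_Gr_times_stabilizer[OF M(1)]) (use S F in auto)
  finally show ?thesis by (simp add: mult_ac)
qed

lemma Gr_nonempty: "Gr M k \<noteq> {}"
  using Gr_between[OF M(1), of "{0}" k] M vec.subspace_0[OF M(1)] by auto

lemma GL_card_pos: "card (GL M) > 0"
  using id_GL[of M] by (auto simp: card_gt_0_iff)

text \<open>By \<open>spread_translate\<close> every translate of a spread has at most one member in
  \<open>F\<close>, so the average is at most 1.\<close>

theorem card_le: "(2 ^ k + 1) * card F \<le> card (Gr M k)"
proof -
  obtain S where S: "spread M k S" using spread_exists[OF M k] by metis
  then have S1: "S \<subseteq> Gr M k" "card S = 2 ^ k + 1" by (simp_all add: spread_def)
  have "(\<Sum>g\<in>GL M. card {A \<in> S. g ` A \<in> F}) \<le> (\<Sum>g\<in>GL M. 1)"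
    by (intro sum_mono spread_translate[OF S])
  then have "card (Gr M k) * (\<Sum>g\<in>GL M. card {A \<in> S. g ` A \<in> F}) \<le> card (Gr M k) * card (GL M)"
    by simp
  then have "((2 ^ k + 1) * card F) * card (GL M) \<le> card (Gr M k) * card (GL M)"
    unfolding spread_average[OF S1(1)] S1(2) .
  then show ?thesis using GL_card_pos mult_le_cancel2 by blast
qed

definition profile :: "nat \<Rightarrow> (bit ^ 'n) set \<Rightarrow> nat" where
  "profile j W = card {Z \<in> F. vec.dim (W \<inter> Z) = j}"

definition deg :: "bit ^ 'n \<Rightarrow> nat" where
  "deg p = card {Z \<in> F. p \<in> Z}"

lemma profile_k:
  assumes "W \<in> Gr M k"
  shows "profile k W = (if W \<in> F then 1 else 0)"
proof -
  have "vec.dim (W \<inter> Z) = k \<longleftrightarrow> Z = W" if "Z \<in> F" for Z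
  proof
    assume d: "vec.dim (W \<inter> Z) = k"
    have Z: "Z \<in> Gr M k" using that F by blast
    have "W \<inter> Z = W" "W \<inter> Z = Z"
      by (rule vec.subspace_dim_equal; use assms Z d in \<open>auto simp: Gr_def intro: vec.subspace_inter\<close>)+
    then show "Z = W" by simp
  qed (use assms in \<open>auto simp: Gr_def\<close>)
  then have "{Z \<in> F. vec.dim (W \<inter> Z) = k} = (if W \<in> F then {W} else {})" by auto
  then show ?thesis by (simp add: profile_def)
qed

text \<open>Pairs of a member \<open>Z\<close> and a nonzero point of \<open>W \<inter> Z\<close>
  are counted in two ways.\<close>

lemma sum_deg:
  assumes "vec.subspace W"
  shows "(\<Sum>p\<in>W - {0}. deg p) = (\<Sum>Z\<in>F. 2 ^ vec.dim (W \<inter> Z) - 1)"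
proof -
  have "(\<Sum>p\<in>W - {0}. deg p) = (\<Sum>Z\<in>F. card {p \<in> W - {0}. p \<in> Z})"
    unfolding deg_def by (rule card_double_count) auto
  also have "\<dots> = (\<Sum>Z\<in>F. 2 ^ vec.dim (W \<inter> Z) - 1)"
  proof (rule sum.cong[OF refl])
    fix Z assume "Z \<in> F"
    then have Z: "vec.subspace (W \<inter> Z)" using F assms by (auto simp: Gr_def intro: vec.subspace_inter)
    have "{p \<in> W - {0}. p \<in> Z} = W \<inter> Z - {0}" by auto
    then show "card {p \<in> W - {0}. p \<in> Z} = 2 ^ vec.dim (W \<inter> Z) - 1"
      using card_nonzero_subspace[OF Z] by simp
  qed
  finally show ?thesis .
qed

text \<open>Members are grouped by the dimension in which they meet \<open>W\<close>, so the profile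
  of \<open>W\<close> determines the degree sum over \<open>W\<close>.\<close>

lemma sum_deg_profile:
  assumes W: "W \<in> Gr M k"
  shows "(\<Sum>p\<in>W - {0}. deg p) = (\<Sum>j\<le>k. profile j W * (2 ^ j - 1))"
proof -
  have sub: "vec.subspace W" using W by (simp add: Gr_def)
  have le: "vec.dim (W \<inter> Z) \<le> k" for Z
    using W vec.dim_subset[of "W \<inter> Z" W] by (auto simp: Gr_def)
  have "(\<Sum>j\<le>k. profile j W * (2 ^ j - 1)) = (\<Sum>j\<le>k. \<Sum>Z\<in>{Z \<in> F. vec.dim (W \<inter> Z) = j}. 2 ^ vec.dim (W \<inter> Z) - 1)"
    by (simp add: profile_def)
  also have "\<dots> = (\<Sum>Z\<in>F. 2 ^ vec.dim (W \<inter> Z) - 1)"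
    by (rule sum.group) (use le in auto)
  finally show ?thesis using sum_deg[OF sub] by simp
qed

end

section \<open>Intersection numbers in the case of equality\<close>

locale extremal_family = intersecting_family +
  assumes extremal: "(2 ^ k + 1) * card F = card (Gr M k)"
begin

text \<open>The counts are at most 1 and extremality makes their average equal to 1, so none of them
  can be smaller.\<close>

lemma spread_translate_eq:
  assumes S: "spread M k S"
    and g: "g \<in> GL M"
  shows "card {A \<in> S. g ` A \<in> F} = 1"
proof (rule ccontr)
  have le: "card {A \<in> S. h ` A \<in> F} \<le> 1" if "h \<in> GL M" for h
    by (rule spread_translate[OF S that])
  assume "card {A \<in> S. g ` A \<in> F} \<noteq> 1"
  then have "card {A \<in> S. g ` A \<in> F} < 1" using le[OF g] by linarith
  then have "(\<Sum>g\<in>GL M. card {A \<in> S. g ` A \<in> F}) < (\<Sum>g\<in>GL M. 1)"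
    using le g by (intro sum_strict_mono_ex1) auto
  moreover have "card (Gr M k) > 0" using Gr_nonempty by (simp add: card_gt_0_iff)
  ultimately have "card (Gr M k) * (\<Sum>g\<in>GL M. card {A \<in> S. g ` A \<in> F}) < card (Gr M k) * card (GL M)"
    by simp
  then show False using spread_average[of S] S extremal by (simp add: spread_def)
qed

text \<open>Each \<open>g\<close> mapping \<open>L\<close> to \<open>W\<close> sends exactly one
  \<open>A\<close> in \<open>S\<close> into \<open>F\<close>; count these \<open>g\<close> by
  \<open>A\<close> and its image \<open>Z\<close>. There are none unless \<open>W \<inter> Z\<close>
  and \<open>L \<inter> A\<close> have equal dimension, and otherwise their number is that for the
  pair \<open>(L, A)\<close> itself. So the coefficients and the right-hand side do not involve
  \<open>W\<close>.\<close>

lemma profile_equation: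
  assumes S: "spread M k S"
    and L: "L \<in> Gr M k" and W: "W \<in> Gr M k"
  shows "(\<Sum>A\<in>S. card {g \<in> GL M. g ` L = L \<and> g ` A = A} * profile (vec.dim (L \<inter> A)) W) =
    card {g \<in> GL M. g ` L = L}"
proof -
  have "card {g \<in> GL M. g ` L = L} = card {g \<in> GL M. g ` L = W}"
    by (rule GL_count[OF M(1) L W])
  also have "\<dots> = (\<Sum>g\<in>{g \<in> GL M. g ` L = W}. card {A \<in> S. g ` A \<in> F})"
    using spread_translate_eq[OF S] by simp
  also have "\<dots> = (\<Sum>A\<in>S. card {g \<in> {g \<in> GL M. g ` L = W}. g ` A \<in> F})"
    by (rule card_double_count) auto
  also have "\<dots> = (\<Sum>A\<in>S. card {g \<in> GL M. g ` L = L \<and> g ` A = A} * profile (vec.dim (L \<inter> A)) W)"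
  proof (rule sum.cong[OF refl])
    fix A assume "A \<in> S"
    then have A: "A \<in> Gr M k" using S by (auto simp: spread_def)
    let ?P = "\<lambda>Z. {g \<in> GL M. g ` L = W \<and> g ` A = Z}"
    have "{g \<in> {g \<in> GL M. g ` L = W}. g ` A \<in> F} = (\<Union>Z\<in>F. ?P Z)" by auto
    then have "card {g \<in> {g \<in> GL M. g ` L = W}. g ` A \<in> F} = (\<Sum>Z\<in>F. card (?P Z))"
      by (simp only:) (rule card_UN_disjoint, auto)
    also have "\<dots> = (\<Sum>Z\<in>F. if vec.dim (W \<inter> Z) = vec.dim (L \<inter> A)
        then card {g \<in> GL M. g ` L = L \<and> g ` A = A} else 0)"
    proof (rule sum.cong[OF refl])
      fix Z assume "Z \<in> F"
      then have Z: "Z \<in> Gr M k" using F by blast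
      show "card (?P Z) = (if vec.dim (W \<inter> Z) = vec.dim (L \<inter> A)
        then card {g \<in> GL M. g ` L = L \<and> g ` A = A} else 0)"
      proof (cases "vec.dim (W \<inter> Z) = vec.dim (L \<inter> A)")
        case True
        then show ?thesis using GL_count_pair[OF M(1) W L Z A] by simp
      next
        case False
        have "?P Z = {}"
        proof (rule ccontr)
          assume "?P Z \<noteq> {}"
          then obtain g where g: "g \<in> GL M" "g ` L = W" "g ` A = Z" by blast
          have "W \<inter> Z = g ` (L \<inter> A)" using g image_Int[OF GL_inj[OF g(1)]] by metis
          moreover have "L \<inter> A \<in> Gr M (vec.dim (L \<inter> A))"
            using L A by (auto simp: Gr_def intro: vec.subspace_inter)
          ultimately show False using False GL_Gr[OF g(1)] by (auto simp: Gr_def)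
        qed
        then show ?thesis using False by (simp only: card.empty if_False)
      qed
    qed
    also have "\<dots> = card {g \<in> GL M. g ` L = L \<and> g ` A = A} * profile (vec.dim (L \<inter> A)) W"
      by (simp add: sum.If_cases profile_def Int_def)
    finally show "card {g \<in> {g \<in> GL M. g ` L = W}. g ` A \<in> F} =
      card {g \<in> GL M. g ` L = L \<and> g ` A = A} * profile (vec.dim (L \<inter> A)) W" .
  qed
  finally show ?thesis by simp
qed

text \<open>The equations \<open>profile_equation\<close> are triangular in \<open>j\<close>: the subspace \<open>L\<close> for \<open>j\<close> meets no element
  of the spread in dimension above \<open>j\<close>. The start is \<open>L\<close> in the spread, which relates \<open>0\<close> and \<open>k\<close>.\<close>
lemma profile_cong:
  assumes W: "W \<in> Gr M k" "W' \<in> Gr M k" "W \<in> F \<longleftrightarrow> W' \<in> F" and "j \<le> k"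
  shows "profile j W = profile j W'"
  using assms(4)
proof (induction j rule: less_induct)
  case (less j)
  obtain S where S: "spread M k S"
    and L: "\<forall>j\<in>{1..k}. \<exists>L\<in>Gr M k. (\<forall>A\<in>S. vec.dim (L \<inter> A) \<le> j) \<and> (\<exists>A\<in>S. vec.dim (L \<inter> A) = j)"
    using spread_exists[OF M k] by metis
  have trivial: "A \<inter> B = {0}" if "A \<in> S" "B \<in> S" "A \<noteq> B" for A B
    using S that by (simp add: spread_def)
  \<comment> \<open>If the profiles agree at every other dimension that occurs for \<open>R\<close>,
    the equation can be solved for \<open>profile j\<close>: its coefficient is positive, since the
    identity is counted in each \<open>c A\<close>.\<close>
  have solve: "profile j W = profile j W'"
    if R: "R \<in> Gr M k" and ex: "\<exists>A\<in>S. vec.dim (R \<inter> A) = j"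
      and other: "\<And>A. A \<in> S \<Longrightarrow> vec.dim (R \<inter> A) \<noteq> j \<Longrightarrow> profile (vec.dim (R \<inter> A)) W = profile (vec.dim (R \<inter> A)) W'"
    for R
  proof -
    define c where "c A = card {g \<in> GL M. g ` R = R \<and> g ` A = A}" for A
    define J where "J = {A \<in> S. vec.dim (R \<inter> A) = j}"
    have split: "(\<Sum>A\<in>S. c A * profile (vec.dim (R \<inter> A)) V) =
        sum c J * profile j V + (\<Sum>A\<in>S - J. c A * profile (vec.dim (R \<inter> A)) V)" for V
    proof -
      have "(\<Sum>A\<in>S. c A * profile (vec.dim (R \<inter> A)) V) =
        (\<Sum>A\<in>J. c A * profile (vec.dim (R \<inter> A)) V) + (\<Sum>A\<in>S - J. c A * profile (vec.dim (R \<inter> A)) V)"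
        by (subst sum.subset_diff[of J S]) (auto simp: J_def)
      moreover have "(\<Sum>A\<in>J. c A * profile (vec.dim (R \<inter> A)) V) = sum c J * profile j V"
        unfolding sum_distrib_right by (rule sum.cong) (auto simp: J_def)
      ultimately show ?thesis by simp
    qed
    have "(\<Sum>A\<in>S - J. c A * profile (vec.dim (R \<inter> A)) W) = (\<Sum>A\<in>S - J. c A * profile (vec.dim (R \<inter> A)) W')"
      using other by (intro sum.cong) (auto simp: J_def)
    then have "sum c J * profile j W = sum c J * profile j W'"
      using split[of W] split[of W'] profile_equation[OF S R W(1)] profile_equation[OF S R W(2)]
      by (simp add: c_def)
    moreover have "c A > 0" for A
      using id_GL[of M] by (auto simp: c_def card_gt_0_iff intro!: exI[of _ id])
    then have "sum c J > 0" using ex by (intro sum_pos) (auto simp: J_def)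
    ultimately show ?thesis by (metis mult_cancel1 less_irrefl)
  qed
  have top: "profile k W = profile k W'"
    using profile_k[OF W(1)] profile_k[OF W(2)] W(3) by simp
  consider "j = k" | "j = 0" | "1 \<le> j" "j < k" using less.prems by linarith
  then show ?case
  proof cases
    case 1
    then show ?thesis using top by simp
  next
    case 2
    have "card S > 1" using S k by (simp add: spread_def)
    then obtain A B where AB: "A \<in> S" "B \<in> S" "A \<noteq> B"
      by (metis One_nat_def card_le_Suc0_iff_eq card.infinite leD not_less_zero)
    have A: "A \<in> Gr M k" using AB S by (auto simp: spread_def)
    show ?thesis
    proof (rule solve[OF A])
      show "\<exists>B\<in>S. vec.dim (A \<inter> B) = j" using AB trivial 2 by (intro bexI[of _ B]) auto
      show "profile (vec.dim (A \<inter> C)) W = profile (vec.dim (A \<inter> C)) W'"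
        if "C \<in> S" "vec.dim (A \<inter> C) \<noteq> j" for C
      proof -
        have "C = A" using that trivial[of A C] AB 2 by force
        then show ?thesis using top A by (simp add: Gr_def)
      qed
    qed
  next
    case 3
    then obtain R where R: "R \<in> Gr M k" "\<forall>A\<in>S. vec.dim (R \<inter> A) \<le> j" "\<exists>A\<in>S. vec.dim (R \<inter> A) = j"
      using L by (meson atLeastAtMost_iff less_imp_le)
    show ?thesis
    proof (rule solve[OF R(1,3)])
      show "profile (vec.dim (R \<inter> A)) W = profile (vec.dim (R \<inter> A)) W'"
        if "A \<in> S" "vec.dim (R \<inter> A) \<noteq> j" for A
      proof (rule less.IH)
        show "vec.dim (R \<inter> A) < j" using R(2) that by fastforce
        then show "vec.dim (R \<inter> A) \<le> k" using 3 by simp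
      qed
    qed
  qed
qed

text \<open>This is the only form in which \<open>deg_shift\<close> uses extremality: the degree sum
  over \<open>W\<close> depends just on membership of \<open>W\<close> in \<open>F\<close>.\<close>

lemma sum_deg_cong:
  assumes "W \<in> Gr M k" "W' \<in> Gr M k" "W \<in> F \<longleftrightarrow> W' \<in> F"
  shows "(\<Sum>p\<in>W - {0}. deg p) = (\<Sum>p\<in>W' - {0}. deg p)"
  unfolding sum_deg_profile[OF assms(1)] sum_deg_profile[OF assms(2)]
  by (rule sum.cong) (use profile_cong[OF assms] in auto)

end

section \<open>Shears and the translation invariance of \<open>deg\<close>\<close>

lemma pow2_diff_square: "(2::nat) ^ (2 * k) - 1 = (2 ^ k + 1) * (2 ^ k - 1)"
  unfolding mult_2 power_add by (simp add: algebra_simps)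

text \<open>On a basis of \<open>R\<close> together with \<open>v\<close>, move only
  \<open>v\<close>. Since \<open>v + u\<close> is also outside \<open>R\<close>, the image is again
  independent and \<open>GL_extend\<close> applies.\<close>

lemma shear_exists:
  fixes M :: "(bit ^ 'n) set"
  assumes M: "vec.subspace M" and R: "vec.subspace R" "R \<subseteq> M" and v: "v \<in> M" "v \<notin> R" and u: "u \<in> R"
  obtains g where "g \<in> GL M" "\<And>x. x \<in> R \<Longrightarrow> g x = x" "g v = v + u"
proof -
  obtain A where A: "A \<subseteq> R" "vec.independent A" "R \<subseteq> vec.span A"
    using vec.maximal_independent_subset by blast
  have sp: "vec.span A = R" using A R by (metis vec.span_minimal subset_antisym)
  have vu: "v + u \<notin> R" using v u R by (simp add: subspace_bit_add_iff)
  define f where "f x = (if x = v then v + u else x)" for x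
  have "v \<notin> A" "v + u \<notin> A" using v vu A by auto
  then have f: "f ` insert v A = insert (v + u) A" "inj_on f (insert v A)"
    by (auto simp: f_def inj_on_def)
  have "vec.independent (insert v A)" "vec.independent (insert (v + u) A)"
    using vec.independent_insertI[of v A] vec.independent_insertI[of "v + u" A] v vu sp A(2) by blast+
  moreover have "insert v A \<subseteq> M" "insert (v + u) A \<subseteq> M"
    using A R v u M by (auto intro: vec.subspace_add)
  ultimately obtain g where g: "g \<in> GL M" "\<And>b. b \<in> insert v A \<Longrightarrow> g b = f b"
    using GL_extend[OF M, of "insert v A" f] f by metis
  have "vec.subspace {x. g x = x}"
    by (rule subspace_bitI) (auto simp: GL_add[OF g(1)] GL_0[OF g(1)])
  moreover have "A \<subseteq> {x. g x = x}" using g(2) \<open>v \<notin> A\<close> by (auto simp: f_def)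
  ultimately have "R \<subseteq> {x. g x = x}" unfolding sp[symmetric] by (intro vec.span_minimal)
  then show ?thesis using that[OF g(1)] g(2)[of v] by (auto simp: f_def)
qed

text \<open>With \<open>p = v\<close> this collects the complements of \<open>U\<close> through
  \<open>v\<close>; a general \<open>p\<close> serves to count those that contain a second
  point.\<close>

definition skew :: "(bit ^ 'n) set \<Rightarrow> nat \<Rightarrow> (bit ^ 'n) set \<Rightarrow> bit ^ 'n \<Rightarrow> bit ^ 'n \<Rightarrow> (bit ^ 'n) set set" where
  "skew M k U v p = {W \<in> Gr M k. U \<inter> W = {0} \<and> v \<in> W \<and> p \<in> W}"

lemma card_skew_le:
  assumes g: "g \<in> GL M" "g ` U = U"
  shows "card (skew M k U v p) \<le> card (skew M k U (g v) (g p))"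
proof (rule card_inj_on_le)
  show "inj_on ((`) g) (skew M k U v p)"
    using GL_inj[OF g(1)] by (auto simp: inj_on_def inj_image_eq_iff)
  show "(`) g ` skew M k U v p \<subseteq> skew M k U (g v) (g p)"
  proof clarify
    fix W assume W: "W \<in> skew M k U v p"
    have "U \<inter> g ` W = g ` (U \<inter> W)" using g image_Int[OF GL_inj[OF g(1)]] by metis
    then show "g ` W \<in> skew M k U (g v) (g p)"
      using W GL_Gr[OF g(1)] GL_0[OF g(1)] by (auto simp: skew_def)
  qed
qed simp

text \<open>The first part uses a shear fixing \<open>U\<close> pointwise, the second one fixing
  \<open>adjoin p U\<close> pointwise, which is possible because \<open>v\<close> is outside
  \<open>adjoin p U\<close>. The reverse inequalities come from
  \<open>v + u + u = v\<close>.\<close>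

lemma card_skew_shift:
  fixes M :: "(bit ^ 'n) set"
  assumes M: "vec.subspace M" and U: "vec.subspace U" "U \<subseteq> M" and v: "v \<in> M" "v \<notin> U" and u: "u \<in> U"
  shows "card (skew M k U v v) = card (skew M k U (v + u) (v + u))"
    "p \<in> M \<Longrightarrow> p \<notin> adjoin v U \<Longrightarrow> card (skew M k U v p) = card (skew M k U (v + u) p)"
proof -
  have vu: "v + u \<in> M" "v + u \<notin> U" "v + u + u = v"
    using v u U M by (auto simp: subspace_bit_add_iff add.assoc intro: vec.subspace_add)
  have le1: "card (skew M k U v v) \<le> card (skew M k U (v + u) (v + u))"
    if v: "v \<in> M" "v \<notin> U" for v
  proof -
    obtain g where g: "g \<in> GL M" "\<And>x. x \<in> U \<Longrightarrow> g x = x" "g v = v + u"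
      using shear_exists[OF M U v u] by metis
    have "g ` U = U" using g(2) by force
    then show ?thesis using card_skew_le[OF g(1), of U k v v] g(3) by simp
  qed
  show "card (skew M k U v v) = card (skew M k U (v + u) (v + u))"
    using le1[OF v] le1[OF vu(1,2)] vu(3) by simp
  assume p: "p \<in> M" "p \<notin> adjoin v U"
  have le2: "card (skew M k U v p) \<le> card (skew M k U (v + u) p)"
    if v: "v \<in> M" "v \<notin> adjoin p U" for v
  proof -
    note ad = adjoin[OF U(1), of p] adjoin_subset[OF M U(2) p(1)]
    have "u \<in> adjoin p U" using u ad by blast
    from shear_exists[OF M ad(1,5) v this]
    obtain g where g: "g \<in> GL M" "\<And>x. x \<in> adjoin p U \<Longrightarrow> g x = x" "g v = v + u"
      by blast
    have "g x = x" if "x \<in> U" for x using g(2) ad(2) that by blast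
    then have "g ` U = U" by force
    moreover have "g p = p" using g(2) ad(3) by blast
    ultimately show ?thesis using card_skew_le[OF g(1), of U k v p] g(3) by simp
  qed
  have "v \<notin> adjoin p U"
  proof
    assume "v \<in> adjoin p U"
    then obtain w where "w \<in> U" "v = p + w" using v by (auto simp: adjoin_def)
    then have "p = v + w" by (simp add: add.assoc)
    then show False using p \<open>w \<in> U\<close> by (auto simp: adjoin_def)
  qed
  moreover have "v + u \<notin> adjoin p U"
    using calculation adjoin[OF U(1), of p] u by (metis subspace_bit_add_iff(2) subsetD)
  ultimately show "card (skew M k U v p) = card (skew M k U (v + u) p)"
    using le2[OF v(1)] le2[OF vu(1)] vu(3) by (metis order_antisym)
qed

context extremal_family
begin

text \<open>Sum \<open>deg\<close> over the nonzero points of all \<open>k\<close>-subspaces through \<open>v\<close> that are complementary to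
  \<open>U\<close>. A point outside \<open>U\<close> and \<open>v + U\<close> contributes equally for \<open>v\<close> and \<open>v + u\<close>, by a shear that moves
  \<open>v\<close> to \<open>v + u\<close>; so the only other contribution, that of \<open>v\<close> itself, is the same too.\<close>
lemma deg_shift:
  assumes U: "U \<in> F" and v: "v \<in> M" "v \<notin> U" and u: "u \<in> U"
  shows "deg (v + u) = deg v"
proof -
  have UG: "U \<in> Gr M k" using U F by blast
  then have U': "vec.subspace U" "U \<subseteq> M" "vec.dim U = k" by (auto simp: Gr_def)
  have vu: "v + u \<in> M" "v + u \<notin> U"
    using v u U' M by (auto simp: subspace_bit_add_iff intro: vec.subspace_add)
  have adj: "adjoin (v + u) U = adjoin v U"
  proof -
    have "(+) u ` U = U"
    proof
      show "(+) u ` U \<subseteq> U" using u U'(1) by (auto intro: vec.subspace_add)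
      show "U \<subseteq> (+) u ` U"
      proof
        fix x assume "x \<in> U"
        then have "u + x \<in> U" using u U'(1) by (intro vec.subspace_add)
        then have "u + (u + x) \<in> (+) u ` U" by (rule imageI)
        then show "x \<in> (+) u ` U" by simp
      qed
    qed
    moreover have "(+) (v + u) ` U = (+) v ` (+) u ` U" by (simp add: image_image add.assoc)
    ultimately have "(+) (v + u) ` U = (+) v ` U" by simp
    then show ?thesis by (simp add: adjoin_def)
  qed
  have ex_skew: "skew M k U v v \<noteq> {}"
  proof -
    have "vec.subspace (vec.span {v})" "vec.span {v} \<subseteq> M"
      using v M by (auto intro: vec.span_minimal[THEN subsetD])
    moreover have "U \<inter> vec.span {v} = {0}"
      using v U' vec.subspace_0 by (auto simp: vec.span_singleton) (metis bit_not_one_iff vec.scale_one vec.scale_zero_left)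
    ultimately obtain B where "B \<in> Gr M (vec.dim M - k)" "vec.span {v} \<subseteq> B" "U \<inter> B = {0}"
      using complement_exists[OF M(1) UG] by metis
    then have "B \<in> skew M k U v v" using M vec.span_superset[of "{v}"] by (auto simp: skew_def)
    then show ?thesis by blast
  qed
  then obtain W0 where W0: "W0 \<in> Gr M k" "U \<inter> W0 = {0}" by (auto simp: skew_def)
  define D where "D = (\<Sum>p\<in>W0 - {0}. deg p)"
  \<comment> \<open>Complements of \<open>U\<close> are outside \<open>F\<close> by
    \<open>meet\<close>, so all of them have the same degree sum \<open>D\<close>.\<close>
  have notF: "W \<notin> F" if "U \<inter> W = {0}" for W using that meet U by blast
  have D: "(\<Sum>p\<in>W - {0}. deg p) = D" if "W \<in> Gr M k" "U \<inter> W = {0}" for W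
    unfolding D_def using sum_deg_cong[OF that(1) W0(1)] notF that W0 by blast
  have eq: "card (skew M k U v v) * D = card (skew M k U v v) * deg v +
      (\<Sum>p\<in>M - adjoin v U. card (skew M k U v p) * deg p)"
    if v: "v \<in> M" "v \<notin> U" for v
  proof -
    have "card (skew M k U v v) * D = (\<Sum>W\<in>skew M k U v v. \<Sum>p\<in>W - {0}. deg p)"
      using D by (simp add: skew_def)
    also have "\<dots> = (\<Sum>W\<in>skew M k U v v. \<Sum>p\<in>M - {0}. if p \<in> W then deg p else 0)"
    proof (rule sum.cong[OF refl])
      fix W assume "W \<in> skew M k U v v"
      then have "(M - {0}) \<inter> W = W - {0}" by (auto simp: skew_def Gr_def)
      then show "(\<Sum>p\<in>W - {0}. deg p) = (\<Sum>p\<in>M - {0}. if p \<in> W then deg p else 0)"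
        by (simp add: sum.If_cases Int_def)
    qed
    also have "\<dots> = (\<Sum>p\<in>M - {0}. \<Sum>W\<in>skew M k U v v. if p \<in> W then deg p else 0)"
      by (rule sum.swap)
    also have "\<dots> = (\<Sum>p\<in>M - {0}. card (skew M k U v p) * deg p)"
    proof (rule sum.cong[OF refl])
      fix p
      have "{W \<in> skew M k U v v. p \<in> W} = skew M k U v p" by (auto simp: skew_def)
      then show "(\<Sum>W\<in>skew M k U v v. if p \<in> W then deg p else 0) = card (skew M k U v p) * deg p"
        by (simp add: sum.If_cases Int_def)
    qed
    \<comment> \<open>The discarded points lie on no such \<open>W\<close>: a nonzero point of
      \<open>U\<close> is not in \<open>W\<close>, and \<open>v + w\<close> in \<open>W\<close> with
      \<open>w\<close> in \<open>U\<close> puts \<open>w\<close> into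
      \<open>U \<inter> W\<close>.\<close>
    also have "\<dots> = (\<Sum>p\<in>insert v (M - adjoin v U). card (skew M k U v p) * deg p)"
    proof (rule sum.mono_neutral_right)
      have "v \<noteq> 0" using v U' vec.subspace_0 by metis
      then show "insert v (M - adjoin v U) \<subseteq> M - {0}"
        using v U' vec.subspace_0[OF U'(1)] by (auto simp: adjoin_def)
      show "\<forall>p\<in>M - {0} - insert v (M - adjoin v U). card (skew M k U v p) * deg p = 0"
      proof
        fix p assume "p \<in> M - {0} - insert v (M - adjoin v U)"
        then have p: "p \<in> adjoin v U" "p \<noteq> 0" "p \<noteq> v" by auto
        have "skew M k U v p = {}"
        proof (rule ccontr)
          assume "skew M k U v p \<noteq> {}"
          then obtain W where W: "W \<in> Gr M k" "U \<inter> W = {0}" "v \<in> W" "p \<in> W" by (auto simp: skew_def)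
          then have sW: "vec.subspace W" by (simp add: Gr_def)
          show False
          proof (cases "p \<in> U")
            case True
            then show ?thesis using W p by blast
          next
            case False
            then obtain w where w: "w \<in> U" "p = v + w" using p by (auto simp: adjoin_def)
            then have "w \<in> W" using W subspace_bit_add_iff[OF sW] by simp
            then have "w = 0" using w W by blast
            then show ?thesis using w p by simp
          qed
        qed
        then show "card (skew M k U v p) * deg p = 0" by simp
      qed
    qed simp
    also have "\<dots> = card (skew M k U v v) * deg v + (\<Sum>p\<in>M - adjoin v U. card (skew M k U v p) * deg p)"
      using adjoin(3)[OF U'(1), of v] by (subst sum.insert) auto
    finally show ?thesis .
  qed
  have same: "(\<Sum>p\<in>M - adjoin v U. card (skew M k U v p) * deg p) =
      (\<Sum>p\<in>M - adjoin (v + u) U. card (skew M k U (v + u) p) * deg p)"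
    unfolding adj by (rule sum.cong) (use card_skew_shift(2)[OF M(1) U'(1,2) v u] in auto)
  have "card (skew M k U v v) * D = card (skew M k U v v) * deg (v + u) +
      (\<Sum>p\<in>M - adjoin v U. card (skew M k U v p) * deg p)"
    unfolding card_skew_shift(1)[OF M(1) U'(1,2) v u, of k] same by (rule eq[OF vu])
  then have "card (skew M k U v v) * deg v = card (skew M k U v v) * deg (v + u)"
    unfolding eq[OF v] by (simp only: add_right_cancel)
  moreover have "card (skew M k U v v) > 0" using ex_skew by (simp add: card_gt_0_iff)
  ultimately show ?thesis by (metis mult_cancel1 less_irrefl)
qed

section \<open>A common point or a proper subspace containing the family\<close>

lemma F_nonempty: "F \<noteq> {}"
  using extremal Gr_nonempty by (auto simp: card_gt_0_iff)

text \<open>Summing a constant \<open>\<delta>\<close> over \<open>M\<close> gives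
  \<open>card F = (2 ^ k + 1) * \<delta>\<close>. Summing over a member \<open>U\<close> gives
  \<open>card F \<le> (2 ^ k - 1) * \<delta>\<close>, as every member has a nonzero point in
  \<open>U\<close>. So \<open>\<delta>\<close> is 0 and \<open>F\<close> would be empty.\<close>

lemma deg_not_constant: "\<not> (\<forall>p\<in>M - {0}. deg p = \<delta>)"
proof
  assume const: "\<forall>p\<in>M - {0}. deg p = \<delta>"
  obtain U where U: "U \<in> F" using F_nonempty by blast
  have sG: "vec.subspace Z" "Z \<subseteq> M" "vec.dim Z = k" if "Z \<in> F" for Z
    using that F by (auto simp: Gr_def)
  have "(2 ^ k - 1) * \<delta> = (\<Sum>p\<in>U - {0}. deg p)"
    using const sG[OF U] card_nonzero_subspace[of U] by (subst sum.cong[of _ "U - {0}" _ "\<lambda>_. \<delta>"]) auto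
  also have "\<dots> = (\<Sum>Z\<in>F. 2 ^ vec.dim (U \<inter> Z) - 1)"
    by (rule sum_deg) (use sG U in blast)
  also have "\<dots> \<ge> (\<Sum>Z\<in>F. 1)"
  proof (rule sum_mono)
    fix Z assume "Z \<in> F"
    then have sub: "vec.subspace (U \<inter> Z)" "U \<inter> Z \<noteq> {0}" using sG U meet by (auto intro: vec.subspace_inter)
    then have "vec.dim (U \<inter> Z) \<noteq> 0" using vec.subspace_0[OF sub(1)] by auto
    then have "1 \<le> vec.dim (U \<inter> Z)" by linarith
    then have "(2::nat) ^ 1 \<le> 2 ^ vec.dim (U \<inter> Z)" by (rule power_increasing) simp
    then have "(2::nat) \<le> 2 ^ vec.dim (U \<inter> Z)" by (simp only: power_one_right)
    then show "1 \<le> (2::nat) ^ vec.dim (U \<inter> Z) - 1" by linarith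
  qed
  finally have 1: "card F \<le> (2 ^ k - 1) * \<delta>" by simp
  have "(2 ^ (2 * k) - 1) * \<delta> = (\<Sum>p\<in>M - {0}. deg p)"
    using const M(2) card_nonzero_subspace[OF M(1)] by (subst sum.cong[of _ "M - {0}" _ "\<lambda>_. \<delta>"]) auto
  also have "\<dots> = (\<Sum>Z\<in>F. 2 ^ vec.dim (M \<inter> Z) - 1)"
    by (rule sum_deg[OF M(1)])
  also have "\<dots> = (\<Sum>Z\<in>F. 2 ^ k - 1)"
    using sG by (intro sum.cong) (auto simp: Int_absorb1)
  finally have 2: "(2 ^ (2 * k) - 1) * \<delta> = card F * (2 ^ k - 1)" by simp
  have "((2 ^ k + 1) * \<delta>) * (2 ^ k - 1) = (2 ^ (2 * k) - 1) * \<delta>"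
    unfolding pow2_diff_square by (simp only: mult_ac)
  also note 2
  finally have "((2 ^ k + 1) * \<delta>) * (2 ^ k - 1) = card F * (2 ^ k - 1)" .
  moreover have "(2::nat) ^ k - 1 > 0" using k one_less_power[of "2::nat" k] by simp
  ultimately have "card F = (2 ^ k + 1) * \<delta>" by (simp only: mult_cancel2) linarith
  with 1 have "(2 ^ k + 1) * \<delta> \<le> (2 ^ k - 1) * \<delta>" by simp
  then have "\<delta> = 0 \<or> (2::nat) ^ k + 1 \<le> 2 ^ k - 1" by (metis mult_le_cancel2 neq0_conv)
  then have "\<delta> = 0" by linarith
  with \<open>card F = (2 ^ k + 1) * \<delta>\<close> show False using F_nonempty by (auto simp: card_gt_0_iff)
qed

lemma common_point_or_hyperplane:
  "(\<exists>p\<in>M - {0}. \<forall>U\<in>F. p \<in> U) \<or> (\<exists>H. vec.subspace H \<and> H \<subseteq> M \<and> H \<noteq> M \<and> (\<forall>U\<in>F. U \<subseteq> H))"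
proof (rule ccontr)
  assume "\<not> ?thesis"
  then have nopoint: "\<And>p. p \<in> M \<Longrightarrow> p \<noteq> 0 \<Longrightarrow> \<exists>U\<in>F. p \<notin> U"
    and nohyp: "\<And>H. vec.subspace H \<Longrightarrow> H \<subseteq> M \<Longrightarrow> H \<noteq> M \<Longrightarrow> \<exists>U\<in>F. \<not> U \<subseteq> H"
    by auto
  have sG: "vec.subspace Z" "Z \<subseteq> M" "vec.dim Z = k" if "Z \<in> F" for Z
    using that F by (auto simp: Gr_def)
  \<comment> \<open>\<open>P T\<close> extends the property of \<open>deg_shift\<close> from members
    of \<open>F\<close> to proper subspaces \<open>T\<close>; a \<open>T\<close> of largest
    dimension is taken. If a member \<open>U\<close> not inside \<open>T\<close> did not complete it
    to \<open>M\<close>, then \<open>T + U\<close> would be a larger choice.\<close>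
  define P where "P T \<longleftrightarrow> vec.subspace T \<and> T \<subseteq> M \<and> T \<noteq> M \<and> (\<forall>v\<in>M - T. \<forall>t\<in>T. deg (v + t) = deg v)" for T
  obtain U0 where U0: "U0 \<in> F" using F_nonempty by blast
  have "U0 \<noteq> M"
  proof
    assume "U0 = M"
    then have "k = 2 * k" using sG(3)[OF U0] M(2) by metis
    then show False using k by simp
  qed
  then have "P U0" using sG[OF U0] deg_shift[OF U0] by (auto simp: P_def)
  then have "\<exists>T. P T \<and> (\<forall>T'. P T' \<longrightarrow> vec.dim T' \<le> vec.dim T)"
    by (rule ex_has_greatest_nat[where b = "Suc (vec.dim M)"]) (auto simp: P_def less_Suc_eq_le intro: vec.dim_subset)
  then obtain T where T: "P T" "\<And>T'. P T' \<Longrightarrow> vec.dim T' \<le> vec.dim T" by blast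
  then have T': "vec.subspace T" "T \<subseteq> M" "T \<noteq> M" "\<And>v t. v \<in> M \<Longrightarrow> v \<notin> T \<Longrightarrow> t \<in> T \<Longrightarrow> deg (v + t) = deg v"
    by (auto simp: P_def)
  obtain U where U: "U \<in> F" "\<not> U \<subseteq> T" using nohyp T' by blast
  note sU = sG[OF U(1)]
  note TU = subspace_add_set[OF T'(1) sU(1)]
  have full: "T + U = M"
  proof (rule ccontr)
    assume ne: "T + U \<noteq> M"
    have "deg (v + (t + u)) = deg v" if "v \<in> M" "v \<notin> T + U" "t \<in> T" "u \<in> U" for v t u
    proof -
      have vt: "v + t \<notin> T + U"
        using that TU subspace_bit_add_iff(2)[OF TU(1), of t v] by blast
      then have "deg (v + t + u) = deg (v + t)"
        using deg_shift[OF U(1), of "v + t" u] that TU M(1) T'(2) by (metis subsetD vec.subspace_add)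
      also have "\<dots> = deg v" using T'(4)[of v t] that TU by blast
      finally show ?thesis by (simp add: add.assoc)
    qed
    then have "P (T + U)"
      unfolding P_def using ne TU add_set_subset[OF M(1) T'(2) sU(2)] by (auto elim!: set_plus_elim)
    then have "vec.dim (T + U) \<le> vec.dim T" by (rule T(2))
    then have "T = T + U" using TU T' by (intro vec.subspace_dim_equal) auto
    then show False using TU U by blast
  qed
  have notsub: "\<not> T \<subseteq> U"
  proof
    assume "T \<subseteq> U"
    then have "M \<subseteq> U" using full sU by (auto simp: set_plus_def subset_iff intro: vec.subspace_add)
    then have "U = M" using sU by blast
    then show False using sU M(2) k by simp
  qed
  obtain t0 where t0: "t0 \<in> T" "t0 \<notin> U" using notsub by blast
  obtain u0 where u0: "u0 \<in> U" "u0 \<notin> T" using U by blast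
  \<comment> \<open>Points off \<open>T\<close> can be moved off \<open>U\<close> as well:
    \<open>t0\<close> is in \<open>T\<close> but not in \<open>U\<close>.\<close>
  have move: "\<exists>x'. x' \<in> M \<and> x' \<notin> T \<and> x' \<notin> U \<and> deg x' = deg x" if "x \<in> M" "x \<notin> T" for x
  proof (cases "x \<in> U")
    case True
    have "x + t0 \<in> M" using that t0 T' M by (auto intro: vec.subspace_add)
    moreover have "x + t0 \<notin> T" "x + t0 \<notin> U"
      using that t0 True T'(1) sU(1) by (simp_all add: subspace_bit_add_iff)
    ultimately show ?thesis using T'(4)[of x t0] that t0 by blast
  qed (use that in blast)
  have off: "deg x = deg y" if x: "x \<in> M" "x \<notin> T" and y: "y \<in> M" "y \<notin> T" for x y
  proof -
    obtain x' where x': "x' \<in> M" "x' \<notin> T" "x' \<notin> U" "deg x' = deg x" using move[OF x] by blast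
    obtain y' where y': "y' \<in> M" "y' \<notin> T" "y' \<notin> U" "deg y' = deg y" using move[OF y] by blast
    have "x' + y' \<in> T + U" unfolding full using x' y' M by (auto intro: vec.subspace_add)
    then obtain t u where tu: "t \<in> T" "u \<in> U" "x' + y' = t + u" by (rule set_plus_elim)
    \<comment> \<open>From \<open>x' + y' = t + u\<close> in characteristic two, a translation by
      \<open>U\<close> and one by \<open>T\<close> lead to the same point, so \<open>x'\<close> and
      \<open>y'\<close> have equal degree.\<close>
    have "x' + u = y' + t"
    proof -
      have "x' + u = (x' + y') + (y' + u)" by (simp add: ac_simps)
      also have "\<dots> = (t + u) + (y' + u)" using tu by simp
      also have "\<dots> = y' + t" by (simp add: ac_simps)
      finally show ?thesis .
    qed
    then have "deg x' = deg (y' + t)" using deg_shift[OF U(1) x'(1,3) tu(2)] by simp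
    also have "\<dots> = deg y'" using T'(4) y' tu by blast
    finally show ?thesis using x' y' by simp
  qed
  define \<delta> where "\<delta> = deg u0"
  have u0M: "u0 \<in> M" using u0 sU by blast
  have d1: "deg x = \<delta>" if "x \<in> M" "x \<notin> T" for x
    using off[OF that u0M u0(2)] by (simp add: \<delta>_def)
  have d2: "deg x = \<delta>" if "x \<in> M" "x \<notin> T \<inter> U" for x
  proof (cases "x \<in> T")
    case True
    then have xU: "x \<notin> U" using that by blast
    have "x + u0 \<notin> T" using True u0 T'(1) by (simp add: subspace_bit_add_iff)
    moreover have "x + u0 \<in> M" using that u0M M by (auto intro: vec.subspace_add)
    ultimately show ?thesis using d1 deg_shift[OF U(1) that(1) xU u0(1)] by metis
  qed (use d1 that in blast)
  have "deg x = \<delta>" if x: "x \<in> M" "x \<noteq> 0" for x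
  proof (cases "x \<in> T \<inter> U")
    case True
    \<comment> \<open>At the remaining points of \<open>T \<inter> U\<close> a member
      \<open>V\<close> that misses \<open>x\<close> helps: it contains some \<open>w\<close> outside
      \<open>U\<close>, and translating by \<open>w\<close> leaves \<open>U\<close>.\<close>
    obtain V where V: "V \<in> F" "x \<notin> V" using nopoint x by blast
    have "\<not> V \<subseteq> U"
    proof
      assume "V \<subseteq> U"
      then have "V = U" using sG[OF V(1)] sU by (intro vec.subspace_dim_equal) auto
      then show False using V True by blast
    qed
    then obtain w where w: "w \<in> V" "w \<notin> U" by blast
    have "x + w \<notin> U" using w True sU(1) by (simp add: subspace_bit_add_iff)
    moreover have "x + w \<in> M" using x w sG[OF V(1)] M by (auto intro: vec.subspace_add)
    ultimately have "deg (x + w) = \<delta>" using d2 by blast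
    then show ?thesis using deg_shift[OF V(1) x(1) V(2) w(1)] by simp
  qed (use d2 x in blast)
  then show False using deg_not_constant by blast
qed

end

section \<open>Pencils, hyperplanes and the number of extremal families\<close>

definition pencil :: "(bit ^ 'n) set \<Rightarrow> nat \<Rightarrow> bit ^ 'n \<Rightarrow> (bit ^ 'n) set set" where
  "pencil M d p = {U \<in> Gr M d. p \<in> U}"

lemma span_singleton_bit: "vec.span {v} = {0, v :: bit ^ 'n}"
proof -
  have "c *s v \<in> {0, v}" for c by (cases "c = 0") auto
  moreover have "0 \<in> vec.span {v}" "v \<in> vec.span {v}" by (auto intro: vec.span_zero vec.span_base)
  ultimately show ?thesis by (auto simp: vec.span_singleton)
qed

lemma line_in_Gr:
  assumes "vec.subspace M" "p \<in> M" "p \<noteq> 0"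
  shows "{0, p} \<in> Gr M 1"
  using assms vec.subspace_span[of "{p}"] vec.subspace_0[OF assms(1)]
    vec.dim_span[of "{p}"] by (simp add: Gr_def span_singleton_bit vec.dim_singleton del: vec.dim_span)

text \<open>Transitivity of \<open>GL M\<close> on nonzero points makes all pencils equally large;
  then incident pairs of points and subspaces are counted in two ways.\<close>

lemma card_pencil:
  fixes M :: "(bit ^ 'n) set"
  assumes M: "vec.subspace M" and p: "p \<in> M" "p \<noteq> 0"
  shows "card (pencil M d p) * (2 ^ vec.dim M - 1) = card (Gr M d) * (2 ^ d - 1)"
proof -
  have le: "card (pencil M d p) \<le> card (pencil M d q)" if pq: "p \<in> M" "p \<noteq> 0" "q \<in> M" "q \<noteq> 0" for p q
  proof -
    obtain g where g: "g \<in> GL M" "g ` {0, p} = {0, q}"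
      using GL_transitive[OF M line_in_Gr[OF M pq(1,2)] line_in_Gr[OF M pq(3,4)]] .
    then have "q \<in> {0, g p}" using GL_0[OF g(1)] by auto
    then have "g p = q" using pq(4) by simp
    show ?thesis
    proof (rule card_inj_on_le)
      show "inj_on ((`) g) (pencil M d p)"
        using GL_inj[OF g(1)] by (auto simp: inj_on_def inj_image_eq_iff)
      show "(`) g ` pencil M d p \<subseteq> pencil M d q"
        using GL_Gr[OF g(1)] \<open>g p = q\<close> by (auto simp: pencil_def)
    qed simp
  qed
  have "(\<Sum>q\<in>M - {0}. card {U \<in> Gr M d. q \<in> U}) = (\<Sum>U\<in>Gr M d. card {q \<in> M - {0}. q \<in> U})"
    by (rule card_double_count) auto
  also have "\<dots> = (\<Sum>U\<in>Gr M d. 2 ^ d - 1)"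
  proof (rule sum.cong[OF refl])
    fix U assume U: "U \<in> Gr M d"
    then have "{q \<in> M - {0}. q \<in> U} = U - {0}" by (auto simp: Gr_def)
    then show "card {q \<in> M - {0}. q \<in> U} = 2 ^ d - 1" using U card_nonzero_subspace[of U] by (simp add: Gr_def)
  qed
  also have "(\<Sum>q\<in>M - {0}. card {U \<in> Gr M d. q \<in> U}) = (\<Sum>q\<in>M - {0}. card (pencil M d p))"
    using le p by (intro sum.cong) (auto simp flip: pencil_def intro: order_antisym)
  finally show ?thesis using card_nonzero_subspace[OF M] by (simp add: mult.commute)
qed

lemma card_pencil_middle:
  fixes M :: "(bit ^ 'n) set"
  assumes M: "vec.subspace M" "vec.dim M = 2 * k" "k > 0" and p: "p \<in> M" "p \<noteq> 0"
  shows "(2 ^ k + 1) * card (pencil M k p) = card (Gr M k)"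
proof -
  have "((2 ^ k + 1) * card (pencil M k p)) * (2 ^ k - 1) = card (pencil M k p) * ((2 ^ k + 1) * (2 ^ k - 1))"
    by (simp only: mult_ac)
  also have "\<dots> = card (Gr M k) * (2 ^ k - 1)"
    using card_pencil[OF M(1) p, of k] unfolding M(2) pow2_diff_square .
  finally have "((2 ^ k + 1) * card (pencil M k p)) * (2 ^ k - 1) = card (Gr M k) * (2 ^ k - 1)" .
  moreover have "(2::nat) ^ k - 1 > 0" using M(3) one_less_power[of "2::nat" k] by simp
  ultimately show ?thesis by (simp only: mult_cancel2) linarith
qed

text \<open>Both follow from the Gaussian binomial formula, since passing from
  \<open>2 * k - 1\<close> to \<open>2 * k\<close> and from \<open>k - 1\<close> to \<open>k\<close>
  contributes the quotient of \<open>2 ^ (2 * k) - 1\<close> by \<open>2 ^ k - 1\<close>. The second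
  equation yields the number in the theorem.\<close>

lemma card_hyperplane_middle:
  fixes M :: "(bit ^ 'n) set"
  assumes M: "vec.subspace M" "vec.dim M = 2 * k" "k > 0" and H: "H \<in> Gr M (2 * k - 1)"
  shows "(2 ^ k + 1) * card (Gr H k) = card (Gr M k)"
    "real (card (Gr H k)) = a_seq (2 * k - 1) / (a_seq k * a_seq (k - 1))"
proof -
  have H': "vec.subspace H" "vec.dim H = 2 * k - 1" using H by (auto simp: Gr_def)
  have "2 * k - 1 - k = k - 1" by simp
  then show eq: "real (card (Gr H k)) = a_seq (2 * k - 1) / (a_seq k * a_seq (k - 1))"
    using card_Gr[OF H'(1), of k] H' M(3) by simp
  have "2 * k = Suc (2 * k - 1)" "k = Suc (k - 1)" using M(3) by auto
  then have a: "a_seq (2 * k) = a_seq (2 * k - 1) * (2 ^ (2 * k) - 1)" "a_seq k = a_seq (k - 1) * (2 ^ k - 1)"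
    using a_seq_Suc by metis+
  have sq: "(2::real) ^ (2 * k) - 1 = (2 ^ k + 1) * (2 ^ k - 1)"
    unfolding mult_2 power_add by (simp add: algebra_simps)
  define q where "q = (2::real) ^ k - 1"
  have q: "q > 0" using M(3) one_less_power[of "2::real" k] by (simp add: q_def)
  have "real (card (Gr M k)) = a_seq (2 * k) / (a_seq k * a_seq k)"
    using card_Gr[OF M(1), of k] M(2) by simp
  also have "\<dots> = (a_seq (2 * k - 1) * ((2 ^ k + 1) * q)) / (a_seq k * (a_seq (k - 1) * q))"
    using a sq by (simp only: q_def)
  also have "\<dots> = (2 ^ k + 1) * (a_seq (2 * k - 1) / (a_seq k * a_seq (k - 1)))"
    using q by simp
  finally have "real (card (Gr M k)) = (2 ^ k + 1) * (a_seq (2 * k - 1) / (a_seq k * a_seq (k - 1)))" .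
  then have "real (card (Gr M k)) = (2 ^ k + 1) * real (card (Gr H k))" unfolding eq .
  then have "real (card (Gr M k)) = real ((2 ^ k + 1) * card (Gr H k))"
    by (simp only: of_nat_mult of_nat_add of_nat_power of_nat_numeral of_nat_1)
  then show "(2 ^ k + 1) * card (Gr H k) = card (Gr M k)" by (simp only: of_nat_eq_iff)
qed

lemma Gr_subset_mono: "H \<subseteq> M \<Longrightarrow> Gr H d \<subseteq> Gr M d"
  by (auto simp: Gr_def)

context extremal_family
begin

text \<open>In either case \<open>F\<close> lies in a family that also attains the bound, so the two
  coincide. A proper subspace is first enlarged to a hyperplane.\<close>

theorem pencil_or_hyperplane:
  "F \<in> pencil M k ` (M - {0}) \<union> (\<lambda>H. Gr H k) ` Gr M (2 * k - 1)"
  using common_point_or_hyperplane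
proof
  assume "\<exists>p\<in>M - {0}. \<forall>U\<in>F. p \<in> U"
  then obtain p where p: "p \<in> M" "p \<noteq> 0" "\<forall>U\<in>F. p \<in> U" by blast
  have "F \<subseteq> pencil M k p" using F p by (auto simp: pencil_def)
  moreover have "(2 ^ k + 1) * card F = (2 ^ k + 1) * card (pencil M k p)"
    using card_pencil_middle[OF M k p(1,2)] extremal by simp
  then have "card F = card (pencil M k p)" by (simp only: mult_cancel1) simp
  ultimately have "F = pencil M k p" by (intro card_subset_eq) auto
  then show ?thesis using p by blast
next
  assume "\<exists>H. vec.subspace H \<and> H \<subseteq> M \<and> H \<noteq> M \<and> (\<forall>U\<in>F. U \<subseteq> H)"
  then obtain R where R: "vec.subspace R" "R \<subseteq> M" "R \<noteq> M" "\<forall>U\<in>F. U \<subseteq> R" by blast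
  have "vec.dim R < vec.dim M"
  proof (rule ccontr)
    assume "\<not> vec.dim R < vec.dim M"
    then have "R = M" using R M by (intro vec.subspace_dim_equal) auto
    then show False using R by blast
  qed
  then have "vec.dim R \<le> 2 * k - 1" "2 * k - 1 \<le> vec.dim M" using M(2) by auto
  then obtain H where H: "H \<in> Gr M (2 * k - 1)" "R \<subseteq> H"
    using Gr_between[OF M(1) R(1,2)] by blast
  have "F \<subseteq> Gr H k" using F R H by (fastforce simp: Gr_def)
  moreover have "(2 ^ k + 1) * card F = (2 ^ k + 1) * card (Gr H k)"
    using card_hyperplane_middle(1)[OF M k H(1)] extremal by simp
  then have "card F = card (Gr H k)" by (simp only: mult_cancel1) simp
  ultimately have "F = Gr H k" by (intro card_subset_eq) auto
  then show ?thesis using H by blast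
qed

end

text \<open>The size is prescribed without division. The condition for \<open>A \<noteq> B\<close>
  is the one supplied by adjacency; \<open>intersecting_familyI\<close> adds the case
  \<open>A = B\<close>, where \<open>k > 0\<close> gives a nonzero member.\<close>

definition extremal_sets :: "(bit ^ 'n) set \<Rightarrow> nat \<Rightarrow> (bit ^ 'n) set set set" where
  "extremal_sets M k = {F. F \<subseteq> Gr M k \<and> (\<forall>A\<in>F. \<forall>B\<in>F. A \<noteq> B \<longrightarrow> A \<inter> B \<noteq> {0}) \<and>
     (2 ^ k + 1) * card F = card (Gr M k)}"

lemma intersecting_familyI:
  fixes M :: "(bit ^ 'n) set"
  assumes "vec.subspace M" "vec.dim M = 2 * k" "k > 0"
    "F \<subseteq> Gr M k" "\<forall>A\<in>F. \<forall>B\<in>F. A \<noteq> B \<longrightarrow> A \<inter> B \<noteq> {0}"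
  shows "intersecting_family M k F"
proof
  show "A \<inter> B \<noteq> {0}" if "A \<in> F" "B \<in> F" for A B
  proof (cases "A = B")
    case True
    then have "vec.dim (A \<inter> B) = k" using that assms(4) by (auto simp: Gr_def)
    then have "vec.dim (A \<inter> B) \<noteq> 0" using assms(3) by linarith
    then show ?thesis by (metis vec.dim_singleton)
  qed (use assms that in blast)
qed (use assms in auto)

lemma Gr_meet:
  fixes H :: "(bit ^ 'n) set"
  assumes "A \<in> Gr H i" "B \<in> Gr H j" "vec.dim H < i + j"
  shows "A \<inter> B \<noteq> {0}"
proof
  assume "A \<inter> B = {0}"
  have A: "vec.subspace A" "vec.subspace B" "A \<subseteq> H" "B \<subseteq> H" "vec.dim A = i" "vec.dim B = j"
    using assms by (auto simp: Gr_def)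
  have "A + B \<subseteq> vec.span H"
    using A vec.span_superset[of H] by (intro add_set_subset) auto
  then have "vec.dim (A + B) \<le> vec.dim H" by (rule vec.dim_mono)
  then show False using dim_add_Int[OF A(1,2)] assms \<open>A \<inter> B = {0}\<close> A by simp
qed

lemma extremal_sets_eq:
  fixes M :: "(bit ^ 'n) set"
  assumes M: "vec.subspace M" "vec.dim M = 2 * k" "k > 0"
  shows "extremal_sets M k = pencil M k ` (M - {0}) \<union> (\<lambda>H. Gr H k) ` Gr M (2 * k - 1)"
proof (intro subset_antisym subsetI)
  fix F assume ext: "F \<in> extremal_sets M k"
  interpret intersecting_family M k F
    using ext M by (intro intersecting_familyI) (auto simp: extremal_sets_def)
  have "(2 ^ k + 1) * card F = card (Gr M k)" using ext unfolding extremal_sets_def by blast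
  then interpret extremal_family M k F by unfold_locales
  show "F \<in> pencil M k ` (M - {0}) \<union> (\<lambda>H. Gr H k) ` Gr M (2 * k - 1)"
    by (rule pencil_or_hyperplane)
next
  fix F assume "F \<in> pencil M k ` (M - {0}) \<union> (\<lambda>H. Gr H k) ` Gr M (2 * k - 1)"
  then show "F \<in> extremal_sets M k"
  proof
    assume "F \<in> pencil M k ` (M - {0})"
    then obtain p where "p \<in> M" "p \<noteq> 0" "F = pencil M k p" by blast
    then show ?thesis
      using card_pencil_middle[OF M, of p] by (auto simp: extremal_sets_def pencil_def)
  next
    assume "F \<in> (\<lambda>H. Gr H k) ` Gr M (2 * k - 1)"
    then obtain H where H: "H \<in> Gr M (2 * k - 1)" "F = Gr H k" by blast
    then have "H \<subseteq> M" "vec.dim H < k + k" using M(3) by (auto simp: Gr_def)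
    then show ?thesis
      using card_hyperplane_middle(1)[OF M H(1)] Gr_subset_mono[of H M k] H(2) Gr_meet[of _ H k _ k]
      by (auto simp: extremal_sets_def)
  qed
qed

lemma card_hyperplanes:
  fixes M :: "(bit ^ 'n) set"
  assumes M: "vec.subspace M" "vec.dim M = m" "m > 0"
  shows "card (Gr M (m - 1)) = 2 ^ m - 1"
proof -
  have "m = Suc (m - 1)" using M by simp
  then have "a_seq m = a_seq (m - 1) * (2 ^ m - 1)" using a_seq_Suc by metis
  moreover have "a_seq (m - (m - 1)) = 1" using M(3) by (simp add: a_seq_def)
  ultimately have "real (card (Gr M (m - 1))) = 2 ^ m - 1"
    using card_Gr[OF M(1), of "m - 1"] M a_seq_pos[of "m - 1"] by simp
  also have "\<dots> = real (2 ^ m - 1)" by (simp add: of_nat_diff)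
  finally show ?thesis by (simp only: of_nat_eq_iff)
qed

text \<open>There are \<open>2 ^ (2 * k) - 1\<close> points and as many hyperplanes, and they give
  different families. For \<open>k = 1\<close> this fails: the pencil of \<open>p\<close> would
  equal the family of the line through \<open>p\<close>.\<close>

lemma card_extremal_sets:
  fixes M :: "(bit ^ 'n) set"
  assumes M: "vec.subspace M" "vec.dim M = 2 * k" "k \<ge> 2"
  shows "card (extremal_sets M k) = 2 ^ (2 * k + 1) - 2"
proof -
  have inj1: "inj_on (pencil M k) (M - {0})"
  proof (rule inj_onI, rule ccontr)
    fix p q assume pq: "p \<in> M - {0}" "q \<in> M - {0}" "pencil M k p = pencil M k q" "p \<noteq> q"
    \<comment> \<open>A hyperplane through \<open>p\<close> that misses \<open>q\<close> contains a
      \<open>k\<close>-dimensional subspace through \<open>p\<close>, which separates the two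
      pencils.\<close>
    have "{0, q} \<inter> {0, p} = {0}" using pq by auto
    moreover have "{0, q} \<in> Gr M 1" "{0, p} \<in> Gr M 1" using pq line_in_Gr[OF M(1)] by auto
    ultimately obtain B where B: "B \<in> Gr M (2 * k - 1)" "{0, p} \<subseteq> B" "{0, q} \<inter> B = {0}"
      using complement_exists[OF M(1), of "{0, q}" 1 "{0, p}"] M(2) by (auto simp: Gr_def)
    have "vec.subspace B" "vec.subspace {0, p}" "vec.dim {0, p} \<le> k" "k \<le> vec.dim B"
      using B(1) line_in_Gr[OF M(1), of p] pq M(3) by (auto simp: Gr_def)
    then obtain U where "U \<in> Gr B k" "{0, p} \<subseteq> U"
      using Gr_between[of B "{0, p}" k] B(2) by blast
    moreover from this have "U \<in> Gr M k" using B(1) Gr_subset_mono[of B M k] by (auto simp: Gr_def)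
    moreover have "q \<notin> U" using B(3) pq \<open>U \<in> Gr B k\<close> by (auto simp: Gr_def)
    ultimately have "U \<in> pencil M k p" "U \<notin> pencil M k q" by (auto simp: pencil_def)
    then show False using pq by simp
  qed
  \<comment> \<open>As \<open>k \<ge> 2\<close>, a \<open>k\<close>-dimensional subspace can pass
    through two prescribed vectors; for \<open>disj\<close> these are \<open>p\<close> and a vector
    off the hyperplane.\<close>
  have through: "\<exists>U \<in> Gr H k. vec.span S \<subseteq> U"
    if "vec.subspace H" "k \<le> vec.dim H" "S \<subseteq> H" "card S \<le> 2" for H and S :: "(bit ^ 'n) set"
  proof -
    have "vec.dim (vec.span S) \<le> k" using vec.dim_le_card[of S S] that(4) M(3) vec.span_superset[of S] by simp
    moreover have "vec.span S \<subseteq> H" using that by (intro vec.span_minimal)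
    ultimately show ?thesis using Gr_between[OF that(1) vec.subspace_span] that(2) by metis
  qed
  have inj2: "inj_on (\<lambda>H. Gr H k) (Gr M (2 * k - 1))"
  proof (rule inj_onI, rule ccontr)
    fix H H' assume H: "H \<in> Gr M (2 * k - 1)" "H' \<in> Gr M (2 * k - 1)" "Gr H k = Gr H' k" "H \<noteq> H'"
    then have d: "vec.subspace H" "vec.subspace H'" "vec.dim H = 2 * k - 1" "vec.dim H' = 2 * k - 1"
      by (auto simp: Gr_def)
    have "\<not> H \<subseteq> H'" using H(4) d vec.subspace_dim_equal[of H H'] by auto
    then obtain x where x: "x \<in> H" "x \<notin> H'" by blast
    have "k \<le> vec.dim H" using d(3) M(3) by linarith
    then obtain U where U: "U \<in> Gr H k" "vec.span {x} \<subseteq> U"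
      using through[OF d(1), of "{x}"] x(1) by auto
    then have "x \<in> U" using vec.span_base[of x "{x}"] by blast
    then have "U \<notin> Gr H' k" using x by (auto simp: Gr_def)
    then show False using U H by blast
  qed
  have disj: "pencil M k ` (M - {0}) \<inter> (\<lambda>H. Gr H k) ` Gr M (2 * k - 1) = {}"
  proof (rule ccontr)
    assume "\<not> ?thesis"
    then obtain p H where pH: "p \<in> M" "p \<noteq> 0" "H \<in> Gr M (2 * k - 1)" "pencil M k p = Gr H k" by blast
    then have "H \<noteq> M" "H \<subseteq> M" using M by (auto simp: Gr_def)
    then obtain x where x: "x \<in> M" "x \<notin> H" by blast
    have "card {p, x} \<le> 2" by (cases "p = x") auto
    moreover have "k \<le> vec.dim M" using M by simp
    moreover have "{p, x} \<subseteq> M" using pH x by blast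
    ultimately obtain U where U: "U \<in> Gr M k" "vec.span {p, x} \<subseteq> U"
      using through[OF M(1), of "{p, x}"] by blast
    then have "p \<in> U" "x \<in> U" using vec.span_base[of _ "{p, x}"] by blast+
    then have "U \<in> pencil M k p" "U \<notin> Gr H k" using U x by (auto simp: pencil_def Gr_def)
    then show False using pH by simp
  qed
  have "card (M - {0}) = 2 ^ (2 * k) - 1"
    using card_nonzero_subspace[OF M(1)] M(2) by simp
  moreover have "card (Gr M (2 * k - 1)) = 2 ^ (2 * k) - 1"
    using card_hyperplanes[OF M(1,2)] M(3) by simp
  moreover have "extremal_sets M k = pencil M k ` (M - {0}) \<union> (\<lambda>H. Gr H k) ` Gr M (2 * k - 1)"
    using M by (intro extremal_sets_eq) auto
  ultimately have eqs: "card (M - {0}) = 2 ^ (2 * k) - 1" "card (Gr M (2 * k - 1)) = 2 ^ (2 * k) - 1"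
    "extremal_sets M k = pencil M k ` (M - {0}) \<union> (\<lambda>H. Gr H k) ` Gr M (2 * k - 1)" by blast+
  have "card (extremal_sets M k) = card (pencil M k ` (M - {0})) + card ((\<lambda>H. Gr H k) ` Gr M (2 * k - 1))"
    unfolding eqs(3) by (rule card_Un_disjoint) (use disj in auto)
  also have "\<dots> = (2 ^ (2 * k) - 1) + (2 ^ (2 * k) - 1)"
    unfolding card_image[OF inj1] card_image[OF inj2] eqs ..
  finally show ?thesis by simp
qed

section \<open>Families without spanning pairs: the levels \<open>i\<close> and
  \<open>2 * k - i\<close>\<close>

lemma complement_degree_sym:
  fixes M :: "(bit ^ 'n) set"
  assumes M: "vec.subspace M" and i: "i \<le> vec.dim M"
    and U: "U \<in> Gr M i" and W: "W \<in> Gr M (vec.dim M - i)"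
  shows "card {Z \<in> Gr M (vec.dim M - i). U \<inter> Z = {0}} = card {Z \<in> Gr M i. Z \<inter> W = {0}}"
proof -
  let ?j = "vec.dim M - i"
  have "card (Gr M i) * card {Z \<in> Gr M ?j. U \<inter> Z = {0}} = (\<Sum>V\<in>Gr M i. card {Z \<in> Gr M ?j. V \<inter> Z = {0}})"
    using complement_degree[OF M _ U] by simp
  also have "\<dots> = (\<Sum>Z\<in>Gr M ?j. card {V \<in> Gr M i. V \<inter> Z = {0}})"
    by (rule card_double_count) auto
  also have "\<dots> = (\<Sum>Z\<in>Gr M ?j. card {V \<in> Gr M i. V \<inter> W = {0}})"
    using complement_degree[OF M _ W, of _ i] by (intro sum.cong) (auto simp: Int_commute)
  \<comment> \<open>Complementary pairs have been counted from both levels; as these are equally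
    large, the common factor cancels.\<close>
  also have "\<dots> = card (Gr M i) * card {V \<in> Gr M i. V \<inter> W = {0}}"
    using card_Gr_sym[OF M i] by simp
  finally show ?thesis using U by auto
qed

definition low_subspaces :: "(bit ^ 'n) set \<Rightarrow> nat \<Rightarrow> (bit ^ 'n) set set" where
  "low_subspaces M k = {I. vec.subspace I \<and> I \<subseteq> M \<and> vec.dim I < k}"

text \<open>This models a clique of the complement ideal graph without the vertex
  \<open>UNIV\<close>. A clique containing \<open>M\<close> is treated separately in
  \<open>clique_card_le\<close>.\<close>

locale nonspanning_family =
  fixes M :: "(bit ^ 'n) set" and k :: nat and C :: "(bit ^ 'n) set set"
  assumes M: "vec.subspace M" "vec.dim M = 2 * k" and k: "k > 0"
    and C: "\<And>I. I \<in> C \<Longrightarrow> vec.subspace I" "\<And>I. I \<in> C \<Longrightarrow> I \<subseteq> M"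
    and proper: "M \<notin> C"
    and nonspan: "\<And>I J. I \<in> C \<Longrightarrow> J \<in> C \<Longrightarrow> I \<noteq> J \<Longrightarrow> I + J \<noteq> M"
begin

lemma sum_eq_iff:
  assumes "A \<in> Gr M i" "B \<in> Gr M (2 * k - i)" "i \<le> 2 * k"
  shows "A + B = M \<longleftrightarrow> A \<inter> B = {0}"
proof -
  have A: "vec.subspace A" "vec.subspace B" "A \<subseteq> M" "B \<subseteq> M" "vec.dim A = i" "vec.dim B = 2 * k - i"
    using assms by (auto simp: Gr_def)
  have dims: "vec.dim (A + B) + vec.dim (A \<inter> B) = 2 * k" using dim_add_Int[OF A(1,2)] A assms(3) by simp
  have sub: "A + B \<subseteq> M" using A M by (intro add_set_subset)
  show ?thesis
  proof
    assume "A + B = M"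
    then have "vec.dim (A \<inter> B) = 0" using dims M(2) by simp
    then show "A \<inter> B = {0}" using A vec.subspace_0 by auto
  next
    assume "A \<inter> B = {0}"
    then have "vec.dim M \<le> vec.dim (A + B)" using dims M(2) by simp
    then show "A + B = M"
      using subspace_add_set(1)[OF A(1,2)] M(1) sub by (intro vec.subspace_dim_equal)
  qed
qed

text \<open>Complements of members on level \<open>2 * k - i\<close> cannot be in \<open>C\<close>,
  so counting edges of the regular complementarity graph gives the inequality. In case of equality
  the chosen upper vertices and the missing lower ones are closed under adjacency, so the upper
  level is chosen entirely or not at all.\<close>

lemma complementary_levels:
  assumes i: "i < k"
  shows "card (C \<inter> Gr M (2 * k - i)) \<le> card (Gr M i - C)"
    "card (C \<inter> Gr M (2 * k - i)) = card (Gr M i - C) \<Longrightarrow> C \<inter> Gr M (2 * k - i) = {}"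
proof -
  define A where "A = Gr M i - C"
  define B where "B = C \<inter> Gr M (2 * k - i)"
  have i': "i \<le> vec.dim M" using i M by simp
  obtain U0 where U0: "U0 \<in> Gr M i"
    using Gr_between[OF M(1), of "{0}" i] i' vec.subspace_0[OF M(1)] by auto
  obtain W0 where W0: "W0 \<in> Gr M (2 * k - i)" "U0 \<inter> W0 = {0}"
    using common_complement[OF M(1) U0 U0] M(2) by auto
  define r where "r = card {Z \<in> Gr M (2 * k - i). U0 \<inter> Z = {0}}"
  have r: "r > 0" using W0 by (auto simp: r_def card_gt_0_iff)
  have r1: "card {Z \<in> Gr M (2 * k - i). U \<inter> Z = {0}} = r" if "U \<in> Gr M i" for U
    unfolding r_def by (rule complement_degree[OF M(1) that U0])
  have r2: "card {U \<in> Gr M i. U \<inter> Z = {0}} = r" if "Z \<in> Gr M (2 * k - i)" for Z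
    using complement_degree_sym[OF M(1) i' U0, of Z] that M(2) by (simp add: r_def)
  have nb: "U \<in> A" if "U \<in> Gr M i" "W \<in> B" "U \<inter> W = {0}" for U W
  proof (rule ccontr)
    assume "U \<notin> A"
    then have UW: "U \<in> C" "W \<in> C" "W \<in> Gr M (2 * k - i)" using that by (auto simp: A_def B_def)
    have "vec.dim U = i" "vec.dim W = 2 * k - i" "2 * k - i \<noteq> i"
      using that(1) UW(3) i by (simp_all add: Gr_def)
    then have "U \<noteq> W" by metis
    moreover have "U + W = M" using sum_eq_iff[OF that(1) UW(3)] that(3) i by simp
    ultimately show False using nonspan UW by blast
  qed
  have "r * card B = (\<Sum>W\<in>B. card {U \<in> Gr M i. U \<inter> W = {0}})"
    using r2 by (simp add: B_def)
  also have "\<dots> = (\<Sum>W\<in>B. card {U \<in> A. U \<inter> W = {0}})"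
    using nb by (intro sum.cong arg_cong[of _ _ card]) (auto simp: A_def)
  also have "\<dots> = (\<Sum>U\<in>A. card {W \<in> B. U \<inter> W = {0}})"
    by (rule card_double_count) auto
  finally have edges: "r * card B = (\<Sum>U\<in>A. card {W \<in> B. U \<inter> W = {0}})" .
  have le: "card {W \<in> B. U \<inter> W = {0}} \<le> r" if "U \<in> A" for U
    using r1[of U] that by (auto simp: A_def B_def intro!: card_mono simp flip: r1[of U])
  have "r * card B \<le> r * card A"
    unfolding edges using sum_mono[of A, OF le] by (simp add: mult.commute)
  then have leBA: "card B \<le> card A" using r by simp
  then show "card (C \<inter> Gr M (2 * k - i)) \<le> card (Gr M i - C)" by (simp add: A_def B_def)
  assume "card (C \<inter> Gr M (2 * k - i)) = card (Gr M i - C)"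
  then have "(\<Sum>U\<in>A. card {W \<in> B. U \<inter> W = {0}}) = (\<Sum>U\<in>A. r)"
    using edges by (simp add: A_def B_def mult.commute)
  then have full: "card {W \<in> B. U \<inter> W = {0}} = r" if "U \<in> A" for U
    using sum_mono_inv[of "\<lambda>U. card {W \<in> B. U \<inter> W = {0}}" A "\<lambda>_. r"] le that by auto
  have closed: "W \<in> B" if "U \<in> A" "W \<in> Gr M (2 * k - i)" "U \<inter> W = {0}" for U W
  proof -
    have "{W \<in> B. U \<inter> W = {0}} = {W \<in> Gr M (2 * k - i). U \<inter> W = {0}}"
      using full[OF that(1)] r1[of U] that(1) by (intro card_subset_eq) (auto simp: A_def B_def)
    then show ?thesis using that by blast
  qed
  show "C \<inter> Gr M (2 * k - i) = {}"
  proof (rule ccontr)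
    assume "C \<inter> Gr M (2 * k - i) \<noteq> {}"
    then obtain W where W: "W \<in> B" "W \<in> Gr M (2 * k - i)" by (auto simp: B_def)
    \<comment> \<open>A common complement of \<open>W\<close> and \<open>W'\<close> passes
      membership on, from \<open>W\<close> down to \<open>A\<close> and up again to
      \<open>W'\<close>.\<close>
    have all: "W' \<in> B" if W': "W' \<in> Gr M (2 * k - i)" for W'
    proof -
      obtain U where U: "U \<in> Gr M (2 * k - (2 * k - i))" "W \<inter> U = {0}" "W' \<inter> U = {0}"
        using common_complement[OF M(1) W(2) W'] M(2) by auto
      then have "U \<in> Gr M i" using i by simp
      then have "U \<in> A" using nb[of U W] W U by (simp add: Int_commute)
      then show ?thesis using closed[of U W'] U W' by (simp add: Int_commute)
    qed
    \<comment> \<open>For \<open>i = 0\<close> the upper level is just \<open>{M}\<close>, which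
      \<open>proper\<close> excludes.\<close>
    have "i \<noteq> 0"
    proof
      assume "i = 0"
      then have "W = M" using W M by (intro vec.subspace_dim_equal) (auto simp: Gr_def)
      then show False using W proper by (auto simp: B_def)
    qed
    \<comment> \<open>A complement \<open>R\<close> of \<open>W\<close> fits into a subspace
      \<open>W'\<close> of the dimension of \<open>W\<close>, because \<open>i < k\<close>. Then
      \<open>W' + W = M\<close>, although both would be in \<open>C\<close>.\<close>
    obtain R where R: "R \<in> Gr M (2 * k - (2 * k - i))" "W \<inter> R = {0}"
      using common_complement[OF M(1) W(2) W(2)] M(2) by auto
    then have R': "vec.subspace R" "R \<subseteq> M" "vec.dim R = i" using i by (auto simp: Gr_def)
    have "vec.dim R \<le> 2 * k - i" "2 * k - i \<le> vec.dim M" using R'(3) i M(2) by linarith+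
    then obtain W' where W': "W' \<in> Gr M (2 * k - i)" "R \<subseteq> W'"
      using Gr_between[OF M(1) R'(1,2)] by blast
    have "W' \<noteq> W"
    proof
      assume "W' = W"
      then have "R = {0}" using W' R by auto
      then show False using R'(3) \<open>i \<noteq> 0\<close> by simp
    qed
    have "R + W = M" using sum_eq_iff[of R i W] R W i by (auto simp: Int_commute)
    then have "M \<subseteq> W' + W" using W'(2) by (auto simp: set_plus_def)
    moreover have "W' + W \<subseteq> M" using W W' M by (intro add_set_subset) (auto simp: Gr_def)
    ultimately have "W' + W = M" by blast
    then show False using nonspan[of W' W] all[OF W'(1)] W(1) \<open>W' \<noteq> W\<close> by (auto simp: B_def)
  qed
qed

lemma card_decompose:
  "card C = card (C \<inter> low_subspaces M k) + card (C \<inter> Gr M k) + (\<Sum>i<k. card (C \<inter> Gr M (2 * k - i)))"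
  "card (low_subspaces M k - C) = (\<Sum>i<k. card (Gr M i - C))"
proof -
  have "low_subspaces M k - C = (\<Union>i<k. Gr M i - C)" by (auto simp: low_subspaces_def Gr_def)
  then show "card (low_subspaces M k - C) = (\<Sum>i<k. card (Gr M i - C))"
    by (simp only:) (rule card_UN_disjoint, auto simp: Gr_def)
  let ?H = "\<Union>i<k. C \<inter> Gr M (2 * k - i)"
  have H: "card ?H = (\<Sum>i<k. card (C \<inter> Gr M (2 * k - i)))"
    by (rule card_UN_disjoint) (auto simp: Gr_def)
  have "I \<in> C \<inter> low_subspaces M k \<union> C \<inter> Gr M k \<union> ?H" if "I \<in> C" for I
  proof -
    have "vec.dim I \<le> 2 * k" using vec.dim_subset[OF C(2)[OF that]] M(2) by simp
    then consider "vec.dim I < k" | "vec.dim I = k" | "vec.dim I = 2 * k - (2 * k - vec.dim I)" "2 * k - vec.dim I < k"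
      by linarith
    then show ?thesis
    proof cases
      case 3
      then have "I \<in> Gr M (2 * k - (2 * k - vec.dim I))" using C that by (auto simp: Gr_def)
      then show ?thesis using 3 that by blast
    qed (use C that in \<open>auto simp: low_subspaces_def Gr_def\<close>)
  qed
  then have "C = (C \<inter> low_subspaces M k \<union> C \<inter> Gr M k) \<union> ?H" by auto
  then have "card C = card ((C \<inter> low_subspaces M k \<union> C \<inter> Gr M k) \<union> ?H)" by simp
  also have "\<dots> = card (C \<inter> low_subspaces M k \<union> C \<inter> Gr M k) + card ?H"
    by (rule card_Un_disjoint) (auto simp: low_subspaces_def Gr_def)
  also have "card (C \<inter> low_subspaces M k \<union> C \<inter> Gr M k) = card (C \<inter> low_subspaces M k) + card (C \<inter> Gr M k)"
    by (rule card_Un_disjoint) (auto simp: low_subspaces_def Gr_def)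
  finally show "card C = card (C \<inter> low_subspaces M k) + card (C \<inter> Gr M k) + (\<Sum>i<k. card (C \<inter> Gr M (2 * k - i)))"
    using H by simp
qed

lemma middle: "intersecting_family M k (C \<inter> Gr M k)"
proof (rule intersecting_familyI[OF M k])
  show "\<forall>A\<in>C \<inter> Gr M k. \<forall>B\<in>C \<inter> Gr M k. A \<noteq> B \<longrightarrow> A \<inter> B \<noteq> {0}"
    using nonspan sum_eq_iff[of _ k] by (auto simp: mult_2)
qed auto

text \<open>What \<open>C\<close> gains above the middle is at most what it misses below, and in the
  middle it has at most \<open>t\<close> members. Equality forces every one of these estimates to be
  sharp.\<close>

theorem card_le:
  assumes t: "(2 ^ k + 1) * t = card (Gr M k)"
  shows "card C \<le> card (low_subspaces M k) + t"
    "card C = card (low_subspaces M k) + t \<Longrightarrow> \<exists>T\<in>extremal_sets M k. C = low_subspaces M k \<union> T"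
proof -
  have cl: "card (low_subspaces M k) = card (C \<inter> low_subspaces M k) + card (low_subspaces M k - C)"
  proof -
    have "card (low_subspaces M k) = card ((C \<inter> low_subspaces M k) \<union> (low_subspaces M k - C))" by (rule arg_cong[of _ _ card]) blast
    also have "\<dots> = card (C \<inter> low_subspaces M k) + card (low_subspaces M k - C)" by (rule card_Un_disjoint) auto
    finally show ?thesis .
  qed
  interpret mid: intersecting_family M k "C \<inter> Gr M k" by (rule middle)
  have "(2 ^ k + 1) * card (C \<inter> Gr M k) \<le> (2 ^ k + 1) * t" using mid.card_le t by simp
  then have le1: "card (C \<inter> Gr M k) \<le> t" by (simp only: mult_le_cancel1)
  have le2: "(\<Sum>i<k. card (C \<inter> Gr M (2 * k - i))) \<le> (\<Sum>i<k. card (Gr M i - C))"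
    using complementary_levels(1) by (intro sum_mono) auto
  show "card C \<le> card (low_subspaces M k) + t" using cl le1 le2 card_decompose by linarith
  assume "card C = card (low_subspaces M k) + t"
  then have eqs: "card (C \<inter> Gr M k) = t" "(\<Sum>i<k. card (C \<inter> Gr M (2 * k - i))) = (\<Sum>i<k. card (Gr M i - C))"
    using cl le1 le2 card_decompose by linarith+
  have "C \<inter> Gr M (2 * k - i) = {}" if "i < k" for i
    using complementary_levels(2)[OF that] sum_mono_inv[OF eqs(2)] complementary_levels(1) that by auto
  then have zero: "(\<Sum>i<k. card (C \<inter> Gr M (2 * k - i))) = 0" by simp
  then have "card (low_subspaces M k - C) = 0" using eqs(2) card_decompose(2) by simp
  then have "low_subspaces M k \<subseteq> C" by auto
  have "card C = card (C \<inter> low_subspaces M k \<union> C \<inter> Gr M k)"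
  proof -
    have "C \<inter> low_subspaces M k \<inter> (C \<inter> Gr M k) = {}" by (auto simp: low_subspaces_def Gr_def)
    then show ?thesis
      using card_decompose(1) zero card_Un_disjoint[of "C \<inter> low_subspaces M k" "C \<inter> Gr M k"] by simp
  qed
  then have "C \<inter> low_subspaces M k \<union> C \<inter> Gr M k = C" by (intro card_subset_eq) auto
  then have "C = low_subspaces M k \<union> (C \<inter> Gr M k)" using \<open>low_subspaces M k \<subseteq> C\<close> by blast
  moreover have "C \<inter> Gr M k \<in> extremal_sets M k"
    using mid.meet eqs(1) t by (auto simp: extremal_sets_def)
  ultimately show "\<exists>T\<in>extremal_sets M k. C = low_subspaces M k \<union> T" by blast
qed

end

section \<open>The complement ideal graph\<close>

text \<open>In a finite graph every clique extends to a maximal one, so comparing with maximal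
  cliques is the same as comparing with all cliques.\<close>

lemma maximum_clique_iff:
  assumes "finite V"
  shows "maximum_clique V E D \<longleftrightarrow>
    D \<subseteq> V \<and> clique D E \<and> (\<forall>D'. D' \<subseteq> V \<and> clique D' E \<longrightarrow> card D' \<le> card D)"
proof
  assume D: "maximum_clique V E D"
  have "card D' \<le> card D" if D': "D' \<subseteq> V" "clique D' E" for D'
  proof -
    let ?P = "\<lambda>A. A \<subseteq> V \<and> clique A E \<and> D' \<subseteq> A"
    have "\<exists>A. ?P A \<and> (\<forall>B. ?P B \<longrightarrow> card B \<le> card A)"
      using D' card_mono[OF assms] by (intro ex_has_greatest_nat[where k = D' and b = "Suc (card V)"]) (auto simp: less_Suc_eq_le)
    then obtain A where A: "?P A" "\<And>B. ?P B \<Longrightarrow> card B \<le> card A" by blast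
    have "B = A" if "B \<subseteq> V" "clique B E" "A \<subseteq> B" for B
    proof -
      have "card B \<le> card A" using A that by blast
      then show ?thesis using that assms card_seteq[of B A] finite_subset by blast
    qed
    then have "maximal_clique V E A" using A by (auto simp: maximal_clique_def)
    then have "card A \<le> card D" using D by (auto simp: maximum_clique_def)
    moreover have "card D' \<le> card A" using A D' by blast
    ultimately show ?thesis by simp
  qed
  then show "D \<subseteq> V \<and> clique D E \<and> (\<forall>D'. D' \<subseteq> V \<and> clique D' E \<longrightarrow> card D' \<le> card D)"
    using D by (auto simp: maximum_clique_def maximal_clique_def)
next
  assume D: "D \<subseteq> V \<and> clique D E \<and> (\<forall>D'. D' \<subseteq> V \<and> clique D' E \<longrightarrow> card D' \<le> card D)"
  have "B = D" if "B \<subseteq> V" "clique B E" "D \<subseteq> B" for B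
    using that D assms card_seteq[of B D] finite_subset by blast
  then show "maximum_clique V E D" using D by (auto simp: maximum_clique_def maximal_clique_def)
qed

text \<open>The multiplication enters the graph only through the list of ideals, so this list is all
  that is assumed about \<open>mul\<close>.\<close>

locale subspace_ideals =
  fixes mul :: "bit ^ 'n \<Rightarrow> bit ^ 'n \<Rightarrow> bit ^ 'n" and M :: "(bit ^ 'n) set" and k :: nat
  assumes ideal: "\<And>I. nr_ideal mul I \<and> I \<noteq> UNIV \<longleftrightarrow> vec.subspace I \<and> I \<subseteq> M"
    and M: "vec.subspace M" "vec.dim M = 2 * k" and M_proper: "M \<noteq> UNIV" and k: "k \<ge> 2"
begin

lemma nr_ideal_iff: "nr_ideal mul I \<longleftrightarrow> I = UNIV \<or> vec.subspace I \<and> I \<subseteq> M"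
proof -
  have "nr_ideal mul UNIV" by (simp add: nr_ideal_def)
  then show ?thesis using ideal[of I] by blast
qed

lemma zero_in_ideal: "nr_ideal mul I \<Longrightarrow> 0 \<in> I"
  by (simp add: nr_ideal_def)

text \<open>An ideal meeting \<open>M\<close> only in 0 is \<open>{0}\<close>, whose complement is
  \<open>UNIV\<close>; so \<open>M\<close> is excluded. Any other subspace of \<open>M\<close> is a
  complement, as an ideal, of one of its vector space complements in \<open>M\<close>.\<close>

lemma complement_ideal_iff: "complement_ideal mul I \<longleftrightarrow> nr_ideal mul I \<and> I \<noteq> M"
proof
  assume "complement_ideal mul I"
  then obtain K where K: "nr_ideal mul K" "complement_of mul K I" by (auto simp: complement_ideal_def)
  have "I \<noteq> M"
  proof
    assume "I = M"
    then have KM: "K \<inter> M = {0}" and max: "\<And>J. nr_ideal mul J \<Longrightarrow> K \<inter> J = {0} \<Longrightarrow> M \<subseteq> J \<Longrightarrow> J = M"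
      using K by (auto simp: complement_of_def)
    have "M \<noteq> {0}" using M k by auto
    then have "K \<noteq> UNIV" using KM by auto
    then have "K \<subseteq> M" using K nr_ideal_iff by blast
    then have "K = {0}" using KM by blast
    then have "UNIV = M" using max[of UNIV] nr_ideal_iff by auto
    then show False using M_proper by simp
  qed
  then show "nr_ideal mul I \<and> I \<noteq> M" using K by (auto simp: complement_of_def)
next
  assume I: "nr_ideal mul I \<and> I \<noteq> M"
  show "complement_ideal mul I"
  proof (cases "I = UNIV")
    case True
    have "vec.subspace {0 :: bit ^ 'n}" "{0} \<subseteq> M" using vec.subspace_0[OF M(1)] by auto
    then have "nr_ideal mul {0}" using nr_ideal_iff by blast
    then have "complement_of mul {0} UNIV" using nr_ideal_iff by (auto simp: complement_of_def)
    then show ?thesis using True \<open>nr_ideal mul {0}\<close> by (auto simp: complement_ideal_def)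
  next
    case False
    then have sI: "vec.subspace I" "I \<subseteq> M" using I nr_ideal_iff by auto
    have lt: "vec.dim I < vec.dim M"
    proof (rule ccontr)
      assume "\<not> vec.dim I < vec.dim M"
      then have "I = M" using sI M by (intro vec.subspace_dim_equal) auto
      then show False using I by blast
    qed
    have iG: "I \<in> Gr M (vec.dim I)" using sI by (simp add: Gr_def)
    have z: "vec.subspace {0 :: bit ^ 'n}" "{0} \<subseteq> M" "I \<inter> {0} = {0}"
      using vec.subspace_0[OF M(1)] vec.subspace_0[OF sI(1)] by auto
    obtain K where K: "K \<in> Gr M (vec.dim M - vec.dim I)" "{0} \<subseteq> K" "I \<inter> K = {0}"
      using complement_exists[OF M(1) iG z] .
    then have sK: "vec.subspace K" "K \<subseteq> M" "vec.dim K = vec.dim M - vec.dim I" by (auto simp: Gr_def)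
    have "J = I" if J: "nr_ideal mul J" "K \<inter> J = {0}" "I \<subseteq> J" for J
    proof -
      \<comment> \<open>Since \<open>K\<close> is nonzero, \<open>J = UNIV\<close> is ruled out, and
        the dimension formula inside \<open>M\<close> bounds \<open>J\<close>.\<close>
      have "K \<noteq> {0}" using lt sK(3) by auto
      then have "J \<noteq> UNIV" using J by auto
      then have sJ: "vec.subspace J" "J \<subseteq> M" using J nr_ideal_iff by auto
      have "vec.dim (J + K) \<le> vec.dim M" using sJ sK M by (intro vec.dim_subset add_set_subset)
      then have "vec.dim J \<le> vec.dim I"
        using dim_add_Int[OF sJ(1) sK(1)] J(2) sK(3) lt by (simp add: Int_commute)
      then show ?thesis using vec.subspace_dim_equal[OF sI(1) sJ(1) J(3)] by simp
    qed
    then have "complement_of mul K I" using I K by (auto simp: complement_of_def Int_commute)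
    moreover have "nr_ideal mul K" using sK nr_ideal_iff by blast
    ultimately show ?thesis by (auto simp: complement_ideal_def)
  qed
qed

lemma add_UNIV_set:
  assumes "0 \<in> I"
  shows "I + UNIV = (UNIV :: (bit ^ 'n) set)" "UNIV + I = (UNIV :: (bit ^ 'n) set)"
proof -
  show "I + UNIV = UNIV" using assms by (auto simp: set_plus_def intro: bexI[of _ 0])
  then show "UNIV + I = UNIV" by (simp add: add.commute)
qed

lemma nr_ideal_add: "nr_ideal mul I \<Longrightarrow> nr_ideal mul J \<Longrightarrow> nr_ideal mul (I + J)"
  using add_UNIV_set[OF zero_in_ideal] subspace_add_set(1)[of I J] add_set_subset[OF M(1), of I J]
  unfolding nr_ideal_iff by metis

lemma edge_iff:
  assumes "nr_ideal mul I" "nr_ideal mul J" "I \<noteq> J"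
  shows "{I, J} \<in> CIG_edges mul \<longleftrightarrow> I + J \<noteq> M"
proof -
  have "{I, J} \<in> CIG_edges mul \<longleftrightarrow> complement_ideal mul (I + J)"
    using assms unfolding CIG_edges_def by (auto simp: doubleton_eq_iff add.commute)
  then show ?thesis using complement_ideal_iff nr_ideal_add[OF assms(1,2)] by simp
qed

lemma clique_iff:
  assumes "D \<subseteq> CIG_verts mul"
  shows "clique D (CIG_edges mul) \<longleftrightarrow> (\<forall>I\<in>D. \<forall>J\<in>D. I \<noteq> J \<longrightarrow> I + J \<noteq> M)"
  using assms edge_iff unfolding CIG_verts_def by (auto simp: clique_def subset_iff)

lemma clique_card_le:
  assumes D: "D \<subseteq> CIG_verts mul" "clique D (CIG_edges mul)" and t: "(2 ^ k + 1) * t = card (Gr M k)" "t > 0"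
  shows "card D \<le> 1 + card (low_subspaces M k) + t"
    "card D = 1 + card (low_subspaces M k) + t \<Longrightarrow> \<exists>T\<in>extremal_sets M k. D = low_subspaces M k \<union> {UNIV} \<union> T"
proof -
  have adj: "I + J \<noteq> M" if "I \<in> D" "J \<in> D" "I \<noteq> J" for I J
    using that D clique_iff by blast
  define C where "C = D - {UNIV}"
  have C: "vec.subspace I" "I \<subseteq> M" if "I \<in> C" for I
    using that D(1) nr_ideal_iff by (auto simp: C_def CIG_verts_def)
  have DC: "card D \<le> 1 + card C" "card D = 1 + card C \<Longrightarrow> D = insert UNIV C"
  proof -
    show "card D \<le> 1 + card C"
      by (cases "UNIV \<in> D") (auto simp: C_def card_Diff_singleton_if)
    assume "card D = 1 + card C"
    then have "UNIV \<in> D" by (cases "UNIV \<in> D") (auto simp: C_def)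
    then show "D = insert UNIV C" by (auto simp: C_def)
  qed
  have main: "card D \<le> 1 + card (low_subspaces M k) + t \<and>
    (card D = 1 + card (low_subspaces M k) + t \<longrightarrow> (\<exists>T\<in>extremal_sets M k. D = low_subspaces M k \<union> {UNIV} \<union> T))"
  proof (cases "M \<in> C")
    \<comment> \<open>\<open>M\<close> absorbs every subspace of \<open>M\<close>, so the clique has
      at most the vertices \<open>M\<close> and \<open>UNIV\<close>. That is below the bound, as
      \<open>{0}\<close> is a low subspace and \<open>t > 0\<close>.\<close>
    case True
    have "I = M" if "I \<in> C" for I
    proof (rule ccontr)
      assume "I \<noteq> M"
      then have "I + M \<noteq> M" using adj[of I M] that True by (auto simp: C_def)
      moreover have "I + M \<subseteq> M" using C[OF that] M(1) by (intro add_set_subset) auto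
      ultimately show False using subspace_add_set(3)[OF C(1)[OF that] M(1)] by blast
    qed
    then have "C = {M}" using True by blast
    then have "card D \<le> 2" using DC(1) by simp
    moreover have "{0} \<in> low_subspaces M k" using vec.subspace_0[OF M(1)] k by (auto simp: low_subspaces_def)
    then have "card (low_subspaces M k) > 0" by (auto simp: card_gt_0_iff)
    ultimately show ?thesis using t(2) by linarith
  next
    case False
    interpret nonspanning_family M k C
      using M k C False adj by unfold_locales (auto simp: C_def)
    show ?thesis
    proof (intro conjI impI)
      show "card D \<le> 1 + card (low_subspaces M k) + t" using DC(1) card_le(1)[OF t(1)] by linarith
      assume eq: "card D = 1 + card (low_subspaces M k) + t"
      then have "card C = card (low_subspaces M k) + t" "card D = 1 + card C" using DC(1) card_le(1)[OF t(1)] by linarith+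
      then obtain T where "T \<in> extremal_sets M k" "C = low_subspaces M k \<union> T" "D = insert UNIV C"
        using card_le(2)[OF t(1)] DC(2) by blast
      then show "\<exists>T\<in>extremal_sets M k. D = low_subspaces M k \<union> {UNIV} \<union> T" by blast
    qed
  qed
  from main show "card D \<le> 1 + card (low_subspaces M k) + t" by blast
  from main show "\<exists>T\<in>extremal_sets M k. D = low_subspaces M k \<union> {UNIV} \<union> T" if "card D = 1 + card (low_subspaces M k) + t"
    using that by blast
qed

text \<open>Two subspaces of dimension at most \<open>k\<close> can span \<open>M\<close> only if
  both have dimension \<open>k\<close> and meet in 0, which is impossible within
  \<open>T\<close>.\<close>

lemma extremal_clique:
  assumes T: "T \<in> extremal_sets M k" and t: "(2 ^ k + 1) * t = card (Gr M k)"
  shows "low_subspaces M k \<union> {UNIV} \<union> T \<subseteq> CIG_verts mul" "clique (low_subspaces M k \<union> {UNIV} \<union> T) (CIG_edges mul)"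
    "card (low_subspaces M k \<union> {UNIV} \<union> T) = 1 + card (low_subspaces M k) + t"
proof -
  have TG: "T \<subseteq> Gr M k" and Tmeet: "\<And>A B. A \<in> T \<Longrightarrow> B \<in> T \<Longrightarrow> A \<noteq> B \<Longrightarrow> A \<inter> B \<noteq> {0}"
    and "(2 ^ k + 1) * card T = (2 ^ k + 1) * t"
    using T t by (auto simp: extremal_sets_def)
  then have cT: "card T = t" by (simp only: mult_cancel1) simp
  show V: "low_subspaces M k \<union> {UNIV} \<union> T \<subseteq> CIG_verts mul"
    using TG by (auto simp: CIG_verts_def nr_ideal_iff low_subspaces_def Gr_def)
  have "I + J \<noteq> M" if IJ: "I \<in> low_subspaces M k \<union> {UNIV} \<union> T" "J \<in> low_subspaces M k \<union> {UNIV} \<union> T" "I \<noteq> J" for I J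
  proof (cases "I = UNIV \<or> J = UNIV")
    case True
    have "0 \<in> I" "0 \<in> J" using IJ V zero_in_ideal by (auto simp: CIG_verts_def)
    then show ?thesis using True add_UNIV_set M_proper by auto
  next
    case False
    then have I: "vec.subspace I" "vec.dim I < k \<or> vec.dim I = k \<and> I \<in> T"
      and J: "vec.subspace J" "vec.dim J < k \<or> vec.dim J = k \<and> J \<in> T"
      using IJ TG by (auto simp: low_subspaces_def Gr_def)
    show ?thesis
    proof
      assume "I + J = M"
      then have "2 * k + vec.dim (I \<inter> J) = vec.dim I + vec.dim J"
        using dim_add_Int[OF I(1) J(1)] M(2) by simp
      then have "vec.dim (I \<inter> J) = 0" "I \<in> T" "J \<in> T" using I(2) J(2) by linarith+
      then have "I \<inter> J = {0}" using I(1) J(1) vec.subspace_0 by auto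
      then show False using Tmeet \<open>I \<in> T\<close> \<open>J \<in> T\<close> IJ(3) by blast
    qed
  qed
  then show "clique (low_subspaces M k \<union> {UNIV} \<union> T) (CIG_edges mul)" using clique_iff[OF V] by blast
  have "low_subspaces M k \<union> {UNIV} \<union> T = insert UNIV (low_subspaces M k \<union> T)" by blast
  moreover have "UNIV \<notin> low_subspaces M k \<union> T" using TG M_proper by (auto simp: low_subspaces_def Gr_def)
  moreover have "card (low_subspaces M k \<union> T) = card (low_subspaces M k) + card T"
    using TG by (intro card_Un_disjoint) (auto simp: low_subspaces_def Gr_def)
  ultimately show "card (low_subspaces M k \<union> {UNIV} \<union> T) = 1 + card (low_subspaces M k) + t" using cT by simp
qed

text \<open>The \<open>k\<close>-dimensional subspaces of a hyperplane are chosen, because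
  \<open>card_hyperplane_middle\<close> gives their number in the required form.\<close>

lemma extremal_set_exists:
  obtains T where "T \<in> extremal_sets M k" "T \<subseteq> Gr M k" "(2 ^ k + 1) * card T = card (Gr M k)" "card T > 0"
    "real (card T) = a_seq (2 * k - 1) / (a_seq k * a_seq (k - 1))"
proof -
  have k0: "k > 0" using k by simp
  have "0 \<in> M" using M(1) by (rule vec.subspace_0)
  then obtain H where H: "H \<in> Gr M (2 * k - 1)"
    using Gr_between[OF M(1), of "{0}" "2 * k - 1"] M(2) by auto
  have "Gr H k \<in> extremal_sets M k" using extremal_sets_eq[OF M k0] H by blast
  moreover from this have "Gr H k \<subseteq> Gr M k" by (simp add: extremal_sets_def)
  moreover note h = card_hyperplane_middle[OF M k0 H]
  moreover have "card (Gr H k) > 0"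
  proof -
    have "real (card (Gr H k)) > 0" unfolding h(2) using a_seq_pos by simp
    then show ?thesis by simp
  qed
  ultimately show ?thesis using that by blast
qed

theorem maximum_cliques:
  "{D. maximum_clique (CIG_verts mul) (CIG_edges mul) D} = (\<lambda>T. low_subspaces M k \<union> {UNIV} \<union> T) ` extremal_sets M k"
proof -
  \<comment> \<open>\<open>T0\<close> supplies the value of \<open>t\<close> for which the upper
    bound is attained.\<close>
  obtain T0 where T0: "T0 \<in> extremal_sets M k" "(2 ^ k + 1) * card T0 = card (Gr M k)" "card T0 > 0"
    using extremal_set_exists by metis
  note bound = clique_card_le[OF _ _ T0(2,3)] and attain = extremal_clique[OF _ T0(2)]
  show ?thesis
  proof (intro subset_antisym subsetI)
    fix D assume "D \<in> {D. maximum_clique (CIG_verts mul) (CIG_edges mul) D}"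
    then have D: "D \<subseteq> CIG_verts mul" "clique D (CIG_edges mul)"
      and max: "\<And>D'. D' \<subseteq> CIG_verts mul \<Longrightarrow> clique D' (CIG_edges mul) \<Longrightarrow> card D' \<le> card D"
      by (auto simp: maximum_clique_iff)
    have "card D = 1 + card (low_subspaces M k) + card T0"
      using bound(1)[OF D] max[OF attain(1,2)[OF T0(1)]] attain(3)[OF T0(1)] by linarith
    then show "D \<in> (\<lambda>T. low_subspaces M k \<union> {UNIV} \<union> T) ` extremal_sets M k" using bound(2)[OF D] by blast
  next
    fix D assume "D \<in> (\<lambda>T. low_subspaces M k \<union> {UNIV} \<union> T) ` extremal_sets M k"
    then obtain T where "T \<in> extremal_sets M k" "D = low_subspaces M k \<union> {UNIV} \<union> T" by blast
    then show "D \<in> {D. maximum_clique (CIG_verts mul) (CIG_edges mul) D}"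
      using attain[of T] bound(1) by (simp add: maximum_clique_iff)
  qed
qed

text \<open>\<open>T\<close> is recovered from its clique by intersecting with
  \<open>Gr M k\<close>, so maximum cliques correspond bijectively to extremal sets.\<close>

theorem card_maximum_cliques:
  "card {D. maximum_clique (CIG_verts mul) (CIG_edges mul) D} = 2 ^ (2 * k + 1) - 2"
proof -
  have "T = T'" if "T \<in> extremal_sets M k" "T' \<in> extremal_sets M k"
    "low_subspaces M k \<union> {UNIV} \<union> T = low_subspaces M k \<union> {UNIV} \<union> T'" for T T'
  proof -
    have "S = (low_subspaces M k \<union> {UNIV} \<union> S) \<inter> Gr M k" if "S \<in> extremal_sets M k" for S
    proof -
      have "S \<subseteq> Gr M k" using that by (simp add: extremal_sets_def)
      moreover have "(low_subspaces M k \<union> {UNIV}) \<inter> Gr M k = {}" using M_proper by (auto simp: low_subspaces_def Gr_def)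
      ultimately show ?thesis by blast
    qed
    then show ?thesis using that by metis
  qed
  then have "inj_on (\<lambda>T. low_subspaces M k \<union> {UNIV} \<union> T) (extremal_sets M k)" by (intro inj_onI) blast
  then show ?thesis
    unfolding maximum_cliques using card_extremal_sets[OF M k] by (simp add: card_image)
qed

end

theorem theorem4p32:
  fixes mul :: "bit ^ 'n \<Rightarrow> bit ^ 'n \<Rightarrow> bit ^ 'n"
    and M :: "(bit ^ 'n) set"
    and m :: nat
  assumes "planar_nearring mul \<or> malone_trivial_nearring mul"
    and "maximal_nr_ideal mul M"
    and "\<And>K. maximal_nr_ideal mul K \<Longrightarrow> K = M"
    and "\<And>I. nr_ideal mul I \<and> I \<noteq> UNIV \<longleftrightarrow> vec.subspace I \<and> I \<subseteq> M"
    and "m = vec.dim M"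
    and "even m" and "m \<ge> 4"
  shows "(\<exists>T. T \<subseteq> {I. nr_ideal mul I \<and> I \<subseteq> M \<and> vec.dim I = m div 2} \<and>
            real (card T) = a_seq (m - 1) / (a_seq (m div 2) * a_seq (m div 2 - 1)) \<and>
            maximum_clique (CIG_verts mul) (CIG_edges mul)
              ({I. nr_ideal mul I \<and> I \<subseteq> M \<and> vec.dim I < m div 2} \<union> {UNIV} \<union> T)) \<and>
         card {C. maximum_clique (CIG_verts mul) (CIG_edges mul) C} = 2 ^ (m + 1) - 2"
proof -
  define k where "k = m div 2"
  have m: "m = 2 * k" using assms(6) by (simp add: k_def)
  have "nr_ideal mul M" "M \<noteq> UNIV" using assms(2) by (auto simp: maximal_nr_ideal_def)
  then have "vec.subspace M" using assms(4)[of M] by blast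
  interpret subspace_ideals mul M k
    by unfold_locales (use assms(4,5,7) m \<open>vec.subspace M\<close> \<open>M \<noteq> UNIV\<close> in auto)
  have below: "nr_ideal mul I \<and> I \<subseteq> M \<longleftrightarrow> vec.subspace I \<and> I \<subseteq> M" for I
    using nr_ideal_iff[of I] \<open>M \<noteq> UNIV\<close> by blast
  have low: "{I. nr_ideal mul I \<and> I \<subseteq> M \<and> vec.dim I < m div 2} = low_subspaces M k"
    and mid: "{I. nr_ideal mul I \<and> I \<subseteq> M \<and> vec.dim I = m div 2} = Gr M k"
    using below by (auto simp: low_subspaces_def Gr_def k_def)
  obtain T where T: "T \<in> extremal_sets M k" "T \<subseteq> Gr M k"
    "real (card T) = a_seq (2 * k - 1) / (a_seq k * a_seq (k - 1))"
    using extremal_set_exists by metis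
  have "maximum_clique (CIG_verts mul) (CIG_edges mul) (low_subspaces M k \<union> {UNIV} \<union> T)"
    using maximum_cliques T(1) by blast
  then have "\<exists>T. T \<subseteq> Gr M k \<and> real (card T) = a_seq (m - 1) / (a_seq (m div 2) * a_seq (m div 2 - 1)) \<and>
      maximum_clique (CIG_verts mul) (CIG_edges mul) (low_subspaces M k \<union> {UNIV} \<union> T)"
    using T(2,3) by (intro exI[of _ T]) (simp add: m)
  then show ?thesis unfolding low mid using card_maximum_cliques by (simp only: m)
qed

end
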